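(* Let $N, M > 0$ be integers. There is an algorithm that computes $D_{n,m,k}$ for all $n \leq N$, all $m \leq M$ and all possible $k$ using $O(N^4 M)$ multiplications of integers, each of bit-size at most $O(\max(M,N)\ln N)$.
   Context: A directed ordered acyclic graph (DOAG) is a tuple $(V, E, (\prec_v)_{v \in V \cup \{\emptyset\}})$ where $V$ is a finite set of vertices, $E \subseteq V \times V$ is a set of edges such that the directed graph $(V,E)$ is acyclic, for each $v \in V$, $\prec_v$ is a total order on the set of outgoing edges of $v$, and $\prec_\emptyset$ is a total order on the set of sources (vertices with no incoming edge). Two DOAGs are considered equal if there is a bijection between their vertex sets preserving the edges and all the orders. $D_{n,m,k}$ denotes the number of DOAGs with $n$ vertices, $m$ edges and $k$ sources. These numbers satisfy the recurrence $D_{1,m,k} = \mathbf{1}[m=0 \wedge k=1]$, $D_{n,m,k} = 0$ when $k \leq 0$, and otherwise $D_{n,m,k} = \sum_{p=0}^{n-k}\sum_{i=0}^{p} D_{n-1,m-p,k-1+p-i}\binom{n-k-p+i}{i}\binom{p}{i} i!$. *)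

theory Defs
  imports Complex_Main "HOL-Library.Log_Nat"
begin

section \<open>Directed ordered acyclic graphs\<close>

record 'a doag =
  verts :: "'a set"
  edges :: "('a \<times> 'a) set"
  out_ord :: "'a \<Rightarrow> ('a \<times> 'a) rel"
  src_ord :: "'a rel"

definition out_edges :: "'a doag \<Rightarrow> 'a \<Rightarrow> ('a \<times> 'a) set" where
  "out_edges G v = {e \<in> edges G. fst e = v}"

definition sources :: "'a doag \<Rightarrow> 'a set" where
  "sources G = {v \<in> verts G. \<nexists>u. (u, v) \<in> edges G}"

text \<open>
  Total orders are taken strict.  The library predicate \<^const>\<open>strict_linear_order_on\<close> does not
  confine the relation to the given set, hence the explicit inclusions.
\<close>

definition is_doag :: "'a doag \<Rightarrow> bool" where
  "is_doag G \<longleftrightarrow>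
     finite (verts G) \<and> edges G \<subseteq> verts G \<times> verts G \<and> acyclic (edges G) \<and>
     (\<forall>v\<in>verts G. out_ord G v \<subseteq> out_edges G v \<times> out_edges G v \<and>
        strict_linear_order_on (out_edges G v) (out_ord G v)) \<and>
     src_ord G \<subseteq> sources G \<times> sources G \<and>
     strict_linear_order_on (sources G) (src_ord G)"

definition doag_iso :: "'a doag \<Rightarrow> 'b doag \<Rightarrow> bool" where
  "doag_iso G H \<longleftrightarrow>
     (\<exists>f. bij_betw f (verts G) (verts H) \<and>
        (\<forall>u\<in>verts G. \<forall>v\<in>verts G. (u, v) \<in> edges G \<longleftrightarrow> (f u, f v) \<in> edges H) \<and>
        (\<forall>v\<in>verts G. \<forall>e\<in>out_edges G v. \<forall>e'\<in>out_edges G v.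
           (e, e') \<in> out_ord G v \<longleftrightarrow> (map_prod f f e, map_prod f f e') \<in> out_ord H (f v)) \<and>
        (\<forall>u\<in>sources G. \<forall>v\<in>sources G. (u, v) \<in> src_ord G \<longleftrightarrow> (f u, f v) \<in> src_ord H))"

text \<open>
  Every finite DOAG has an isomorphic copy whose vertices are natural numbers, so DOAGs up to
  isomorphism may be counted on that vertex type.
\<close>

definition doags :: "nat \<Rightarrow> nat \<Rightarrow> nat \<Rightarrow> nat doag set" where
  "doags n m k =
     {G. is_doag G \<and> card (verts G) = n \<and> card (edges G) = m \<and> card (sources G) = k}"

definition num_doags :: "nat \<Rightarrow> nat \<Rightarrow> nat \<Rightarrow> nat" where
  "num_doags n m k =
     card (doags n m k // {(G, H). G \<in> doags n m k \<and> H \<in> doags n m k \<and> doag_iso G H})"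


section \<open>Algorithms\<close>

text \<open>
  Algorithms are programs of a deterministic imperative language over unbounded integers.  The
  only arithmetic is addition, subtraction and multiplication; branching is on integer
  comparison.  Variables are multi-dimensional arrays, a scalar being an array with empty index
  list, so that no hidden multiplication is needed for addressing.
\<close>

type_synonym mem = "string \<Rightarrow> int list \<Rightarrow> int"

datatype arith_op = Add | Sub | Mul

datatype expr =
    Num int
  | Cell string "expr list"
  | Op arith_op expr expr

datatype com =
    Skip
  | Assign string "expr list" expr
  | Seq com com
  | If_Less expr expr com com
  | While_Less expr expr com

text \<open>
  A run is accompanied by the list of elementary operations it performs, arithmetic operations
  being recorded with the values of their operands.
\<close>

datatype event = Arith arith_op int int | Compare | Store

fun apply_op :: "arith_op \<Rightarrow> int \<Rightarrow> int \<Rightarrow> int" where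
  "apply_op Add x y = x + y"
| "apply_op Sub x y = x - y"
| "apply_op Mul x y = x * y"

fun eval :: "mem \<Rightarrow> expr \<Rightarrow> int" where
  "eval s (Num c) = c"
| "eval s (Cell x is) = s x (map (eval s) is)"
| "eval s (Op f a b) = apply_op f (eval s a) (eval s b)"

fun events :: "mem \<Rightarrow> expr \<Rightarrow> event list" where
  "events s (Num c) = []"
| "events s (Cell x is) = concat (map (events s) is)"
| "events s (Op f a b) = events s a @ events s b @ [Arith f (eval s a) (eval s b)]"

text \<open>
  \<open>exec c s tr s'\<close>: started in memory \<open>s\<close>, the program \<open>c\<close> terminates in memory \<open>s'\<close>, having
  performed the operations \<open>tr\<close>.
\<close>

inductive exec :: "com \<Rightarrow> mem \<Rightarrow> event list \<Rightarrow> mem \<Rightarrow> bool" where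
  Skip: "exec Skip s [] s"
| Assign: "exec (Assign x is a) s (concat (map (events s) is) @ events s a @ [Store])
     (s(x := (s x)(map (eval s) is := eval s a)))"
| Seq: "exec c1 s tr1 s1 \<Longrightarrow> exec c2 s1 tr2 s2 \<Longrightarrow> exec (Seq c1 c2) s (tr1 @ tr2) s2"
| If_True: "eval s a < eval s b \<Longrightarrow> exec c1 s tr s' \<Longrightarrow>
     exec (If_Less a b c1 c2) s (events s a @ events s b @ Compare # tr) s'"
| If_False: "\<not> eval s a < eval s b \<Longrightarrow> exec c2 s tr s' \<Longrightarrow>
     exec (If_Less a b c1 c2) s (events s a @ events s b @ Compare # tr) s'"
| While_False: "\<not> eval s a < eval s b \<Longrightarrow>
     exec (While_Less a b c) s (events s a @ events s b @ [Compare]) s"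
| While_True: "eval s a < eval s b \<Longrightarrow> exec c s tr1 s1 \<Longrightarrow>
     exec (While_Less a b c) s1 tr2 s2 \<Longrightarrow>
     exec (While_Less a b c) s (events s a @ events s b @ Compare # tr1 @ tr2) s2"

inductive_cases exec_SkipE: "exec Skip s tr s'"
inductive_cases exec_AssignE: "exec (Assign x is a) s tr s'"
inductive_cases exec_SeqE: "exec (Seq c1 c2) s tr s'"
inductive_cases exec_IfE: "exec (If_Less a b c1 c2) s tr s'"
inductive_cases exec_WhileE: "exec (While_Less a b c) s tr s'"

lemma exec_deterministic:
  "exec c s tr s' \<Longrightarrow> exec c s tr' s'' \<Longrightarrow> tr' = tr \<and> s'' = s'"
proof (induction arbitrary: tr' s'' rule: exec.induct)
  case (Seq c1 s tr1 s1 c2 tr2 s2)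
  from Seq.prems show ?case by (rule exec_SeqE) (use Seq.IH in blast)
next
  case (While_True s a b c tr1 s1 tr2 s2)
  from While_True.prems show ?case
    by (rule exec_WhileE) (use While_True.hyps(1) While_True.IH in blast)+
qed (blast elim: exec_SkipE exec_AssignE exec_IfE exec_WhileE)+

definition mults :: "event list \<Rightarrow> (int \<times> int) list" where
  "mults tr = [(x, y). Arith Mul x y \<leftarrow> tr]"

text \<open>The input \<open>(N, M)\<close> is held in two scalars; all other memory is zero.\<close>

definition input :: "nat \<Rightarrow> nat \<Rightarrow> mem" where
  "input N M = (\<lambda>_ _. 0)(''N'' := (\<lambda>_. 0)([] := int N), ''M'' := (\<lambda>_. 0)([] := int M))"

text \<open>The bit-size of \<open>x\<close> is \<open>bitlen \<bar>x\<bar>\<close>, which is \<open>0\<close> for \<open>x = 0\<close>.\<close>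

definition bit_size :: "int \<Rightarrow> real" where
  "bit_size x = of_int (bitlen \<bar>x\<bar>)"

end

theory Submission
  imports Defs
begin

text \<open>
  Repeatedly removing the first source of a DOAG and appending the vertices thereby freed, in the
  order of its outgoing edges, to the queue of sources lists the vertices in a canonical order.
  The successor lists, written as positions in the rest of this order, form a complete isomorphism
  invariant, so DOAGs up to isomorphism are counted by such codes.  The first list of a code
  interleaves the \<open>q\<close> freed vertices, in increasing order, with \<open>i\<close> distinct others out of
  \<open>a = n - k - q\<close>; the number \<open>weave a q i\<close> of such interleavings equals
  \<open>(q + i choose i) * (a choose i) * i!\<close>, and with \<open>p = q + i\<close> the recurrence for \<open>D\<^sub>n\<^sub>,\<^sub>m\<^sub>,\<^sub>k\<close> follows.
  The numbers \<open>weave a q i\<close> satisfy a recurrence with one multiplication by \<open>a\<close>, so they are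
  tabulated first; the recurrence then yields the DOAG table in \<open>O(N\<^sup>4 M)\<close> operations.  For
  \<open>L > n\<close> one gets \<open>D\<^sub>n\<^sub>,\<^sub>m\<^sub>,\<^sub>k \<le> L\<^bsup>2n+m\<^esup>\<close> by induction, which bounds the operands.
\<close>


section \<open>Finite strict linear orders as lists\<close>

abbreviation sorted_by :: "'a rel \<Rightarrow> 'a list \<Rightarrow> bool" where
  "sorted_by R \<equiv> sorted_wrt (\<lambda>x y. (x, y) \<in> R)"

lemma sorted_by_distinct: "irrefl R \<Longrightarrow> sorted_by R xs \<Longrightarrow> distinct xs"
  by (induction xs) (auto simp: irrefl_def)

lemma sorted_by_exists:
  assumes "finite S" "strict_linear_order_on S R"
  shows "\<exists>xs. set xs = S \<and> sorted_by R xs"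
  using assms
proof (induction S rule: finite_induct)
  case (insert x S)
  then have R: "trans R" "irrefl R" "total_on (insert x S) R"
    by (auto simp: strict_linear_order_on_def)
  from insert obtain xs where xs: "set xs = S" "sorted_by R xs"
    by (auto simp: strict_linear_order_on_def total_on_def)
  \<comment> \<open>The new element goes between its predecessors and its successors in the old
    list; by totality these two parts exhaust it.\<close>
  let ?ys = "filter (\<lambda>y. (y, x) \<in> R) xs @ x # filter (\<lambda>y. (x, y) \<in> R) xs"
  have "set ?ys = insert x S"
    using R(3) xs(1) insert.hyps(2) by (auto simp: total_on_def)
  moreover have "sorted_by R ?ys"
    using xs(2) R(1) by (auto simp: sorted_wrt_append sorted_wrt_filter dest: transD)
  ultimately show ?case by blast
qed simp

text \<open>If the heads differed, each would precede the other, against transitivity and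
  irreflexivity.\<close>

lemma sorted_by_unique:
  assumes "trans R" "irrefl R" "sorted_by R xs" "sorted_by R ys" "set xs = set ys"
  shows "xs = ys"
  using assms(3-)
proof (induction xs arbitrary: ys)
  case (Cons x xs)
  then obtain y zs where ys: "ys = y # zs" by (cases ys) auto
  have "x = y"
  proof (rule ccontr)
    assume "x \<noteq> y"
    with Cons.prems ys have "(x, y) \<in> R" "(y, x) \<in> R" by auto
    with assms(1,2) show False by (meson irrefl_def transD)
  qed
  moreover have "x \<notin> set xs" "y \<notin> set zs"
    using Cons.prems assms(2) ys by (auto simp: irrefl_def)
  ultimately have "set xs = set zs" using Cons.prems ys by (metis insert_ident list.simps(15))
  with Cons ys \<open>x = y\<close> show ?case by simp
qed simp

lemma sorted_by_nth_iff:
  assumes "trans R" "irrefl R" "sorted_by R xs" "i < length xs" "j < length xs"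
  shows "(xs ! i, xs ! j) \<in> R \<longleftrightarrow> i < j"
proof
  assume *: "(xs ! i, xs ! j) \<in> R"
  show "i < j"
  proof (rule ccontr)
    assume "\<not> i < j"
    then consider "i = j" | "j < i" by linarith
    then show False
    proof cases
      case 2
      with assms have "(xs ! j, xs ! i) \<in> R" by (simp add: sorted_wrt_iff_nth_less)
      with * assms(1,2) show False by (meson irrefl_def transD)
    qed (use * assms(2) in \<open>auto simp: irrefl_def\<close>)
  qed
qed (use assms in \<open>simp add: sorted_wrt_iff_nth_less\<close>)

definition ordered_list :: "'a set \<Rightarrow> 'a rel \<Rightarrow> 'a list" where
  "ordered_list S R = (THE xs. set xs = S \<and> sorted_by R xs)"

lemma ordered_list_eqI:
  assumes "strict_linear_order_on S R" "set xs = S" "sorted_by R xs"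
  shows "ordered_list S R = xs"
  unfolding ordered_list_def
  by (rule the_equality)
     (use assms sorted_by_unique in \<open>auto simp: strict_linear_order_on_def\<close>)

lemma ordered_list:
  assumes "finite S" "strict_linear_order_on S R"
  shows "set (ordered_list S R) = S" "sorted_by R (ordered_list S R)" "distinct (ordered_list S R)"
proof -
  obtain xs where xs: "set xs = S" "sorted_by R xs"
    using sorted_by_exists[OF assms] by blast
  then show "set (ordered_list S R) = S" "sorted_by R (ordered_list S R)"
    using ordered_list_eqI[OF assms(2) xs] by auto
  then show "distinct (ordered_list S R)"
    using assms(2) sorted_by_distinct by (auto simp: strict_linear_order_on_def)
qed

text \<open>Both relations compare positions, and \<open>f\<close> carries each element to the one
  at the same position. This turns equality of lists back into preservation of orders.\<close>

lemma ordered_list_map_iff: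
  assumes "finite S" "strict_linear_order_on S R" "finite T" "strict_linear_order_on T Q"
    and "ordered_list T Q = map f (ordered_list S R)" "x \<in> S" "y \<in> S"
  shows "(x, y) \<in> R \<longleftrightarrow> (f x, f y) \<in> Q"
proof -
  let ?xs = "ordered_list S R"
  obtain i j where ij: "i < length ?xs" "x = ?xs ! i" "j < length ?xs" "y = ?xs ! j"
    using assms(6,7) ordered_list(1)[OF assms(1,2)] by (metis in_set_conv_nth)
  have "(x, y) \<in> R \<longleftrightarrow> i < j"
    using sorted_by_nth_iff ordered_list(2)[OF assms(1,2)] assms(2) ij
    by (auto simp: strict_linear_order_on_def)
  moreover have "(map f ?xs ! i, map f ?xs ! j) \<in> Q \<longleftrightarrow> i < j"
    using sorted_by_nth_iff[of Q "map f ?xs" i j] ordered_list(2)[OF assms(3,4)] assms(4,5) ij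
    by (auto simp: strict_linear_order_on_def)
  ultimately show ?thesis using ij by simp
qed

text \<open>The strict order read off from a list; it supplies the orders of the graph built from a
  code.\<close>

definition position_order :: "'a list \<Rightarrow> 'a rel" where
  "position_order xs = {(xs ! i, xs ! j) |i j. i < j \<and> j < length xs}"

lemma position_order:
  assumes "distinct xs"
  shows "position_order xs \<subseteq> set xs \<times> set xs"
    and "strict_linear_order_on (set xs) (position_order xs)"
    and "sorted_by (position_order xs) xs"
proof -
  show "position_order xs \<subseteq> set xs \<times> set xs"
    by (auto simp: position_order_def)
  have "trans (position_order xs)"
  proof (rule transI)
    fix x y z assume "(x, y) \<in> position_order xs" "(y, z) \<in> position_order xs"
    then obtain i j j' k where "x = xs ! i" "y = xs ! j" "i < j" "j < length xs"
      "y = xs ! j'" "z = xs ! k" "j' < k" "k < length xs"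
      unfolding position_order_def by blast
    moreover from this have "j = j'" using assms by (simp add: nth_eq_iff_index_eq)
    ultimately show "(x, z) \<in> position_order xs"
      unfolding position_order_def by fastforce
  qed
  moreover have "irrefl (position_order xs)"
    using assms by (auto simp: irrefl_def position_order_def nth_eq_iff_index_eq)
  moreover have "total_on (set xs) (position_order xs)"
  proof (rule total_onI)
    fix x y assume "x \<in> set xs" "y \<in> set xs" "x \<noteq> y"
    then obtain i j where "x = xs ! i" "y = xs ! j" "i < length xs" "j < length xs" "i \<noteq> j"
      by (auto simp: in_set_conv_nth)
    then show "(x, y) \<in> position_order xs \<or> (y, x) \<in> position_order xs"
      unfolding position_order_def by (metis (mono_tags, lifting) linorder_neqE_nat mem_Collect_eq)
  qed
  ultimately show "strict_linear_order_on (set xs) (position_order xs)"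
    by (simp add: strict_linear_order_on_def)
  show "sorted_by (position_order xs) xs"
    by (auto simp: sorted_wrt_iff_nth_less position_order_def)
qed


section \<open>Canonical codes of ordered graphs\<close>

definition targets :: "('a \<Rightarrow> 'a list) \<Rightarrow> 'a set \<Rightarrow> 'a set" where
  "targets s V = (\<Union>u\<in>V. set (s u))"

text \<open>
  In a code the entries of each list are positions in the rest of the vertex list, so a removed
  vertex leaves the remaining code unchanged.  With \<open>k\<close> sources, these are the positions
  below \<open>k\<close>; the number \<open>K\<close> in \<open>valid\<close> counts the sources after the removal.
\<close>

fun coded :: "('a \<Rightarrow> 'a list) \<Rightarrow> 'a list \<Rightarrow> nat list list \<Rightarrow> bool" where
  "coded s [] [] \<longleftrightarrow> True"
| "coded s (v # vs) (l # L) \<longleftrightarrow>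
     s v = map ((!) vs) l \<and> (\<forall>x\<in>set l. x < length vs) \<and> coded s vs L"
| "coded s _ _ \<longleftrightarrow> False"

text \<open>Positions below \<open>k - 1\<close> are the sources that stay in the queue, so no edge
  may point there. The entries below \<open>K\<close> are the vertices freed by the removal; listing
  them as \<open>[k - 1..<K]\<close> makes their queue order follow the outgoing edges.\<close>

fun valid :: "nat \<Rightarrow> nat list list \<Rightarrow> bool" where
  "valid k [] \<longleftrightarrow> k = 0"
| "valid k (l # L) \<longleftrightarrow> 0 < k \<and> distinct l \<and> set l \<subseteq> {k - 1..<length L} \<and>
     (\<exists>K\<ge>k - 1. valid K L \<and> filter (\<lambda>x. x < K) l = [k - 1..<K])"

lemma coded_length: "coded s vs L \<Longrightarrow> length L = length vs"
  by (induction s vs L rule: coded.induct) auto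

lemma valid_le_length: "valid k L \<Longrightarrow> k \<le> length L"
proof (induction L arbitrary: k)
  case (Cons l L)
  then show ?case by fastforce
qed simp

text \<open>The tail fixes \<open>K\<close>, and the first list has exactly
  \<open>K - (k - 1)\<close> entries below \<open>K\<close>. So a code determines its number of
  sources.\<close>

lemma valid_unique: "valid k L \<Longrightarrow> valid k' L \<Longrightarrow> k = k'"
proof (induction L arbitrary: k k')
  case (Cons l L)
  then obtain K K' where K: "k - 1 \<le> K" "valid K L" "filter (\<lambda>x. x < K) l = [k - 1..<K]"
    "k' - 1 \<le> K'" "valid K' L" "filter (\<lambda>x. x < K') l = [k' - 1..<K']"
    by auto
  with Cons.IH have "K = K'" by blast
  with K have "[k - 1..<K] = [k' - 1..<K]" by simp
  then have "K - (k - 1) = K - (k' - 1)" by (metis length_upt)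
  with K \<open>K = K'\<close> Cons.prems show ?case by auto
qed simp

lemma valid_nth:
  "valid k L \<Longrightarrow> j < length L \<Longrightarrow> distinct (L ! j) \<and> (\<forall>x\<in>set (L ! j). x < length L - Suc j)"
proof (induction L arbitrary: k j)
  case (Cons l L)
  then show ?case by (cases j) auto
qed simp

lemma coded_targets: "coded s vs L \<Longrightarrow> targets s (set vs) \<subseteq> set vs"
proof (induction s vs L rule: coded.induct)
  case (2 s v vs l L)
  then have "set (s v) \<subseteq> set vs" by auto
  with 2 show ?case by (auto simp: targets_def)
qed (auto simp: targets_def)

lemma coded_nth:
  "coded s vs L \<Longrightarrow> j < length vs \<Longrightarrow>
     s (vs ! j) = map (\<lambda>x. vs ! (Suc j + x)) (L ! j) \<and>
     (\<forall>x\<in>set (L ! j). Suc j + x < length vs)"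
proof (induction s vs L arbitrary: j rule: coded.induct)
  case (2 s v vs l L)
  then show ?case by (cases j) auto
qed auto

lemma coded_map:
  "coded s vs L \<Longrightarrow> (\<And>v. v \<in> set vs \<Longrightarrow> t (f v) = map f (s v)) \<Longrightarrow> coded t (map f vs) L"
  by (induction s vs L rule: coded.induct) auto

lemma coded_sum_list:
  "coded s vs L \<Longrightarrow> sum_list (map (\<lambda>v. length (s v)) vs) = sum_list (map length L)"
  by (induction s vs L rule: coded.induct) auto

text \<open>Below position \<open>K\<close> lie the sources of the rest, and the removed vertex
  points precisely at those from \<open>k - 1\<close> on. The first \<open>k - 1\<close> of them
  remain sources of the whole graph.\<close>

lemma sources_of_valid:
  "valid k L \<Longrightarrow> coded s vs L \<Longrightarrow> distinct vs \<Longrightarrow>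
     set (take k vs) = set vs - targets s (set vs)"
proof (induction L arbitrary: k vs)
  case Nil
  then show ?case by (cases vs) auto
next
  case (Cons l L)
  then obtain v r where vs: "vs = v # r" by (cases vs) auto
  from Cons.prems obtain K where K: "k - 1 \<le> K" "valid K L" "filter (\<lambda>x. x < K) l = [k - 1..<K]"
    and k: "0 < k" by auto
  from Cons.prems vs have r: "coded s r L" "distinct r" "v \<notin> set r" "s v = map ((!) r) l"
    "\<forall>x\<in>set l. x < length r" by auto
  have Kr: "K \<le> length r" using valid_le_length[OF K(2)] coded_length[OF r(1)] by simp
  have mem: "r ! x \<in> set (s v) \<longleftrightarrow> k - 1 \<le> x" if "x < K" for x
  proof -
    have "r ! x \<in> set (s v) \<longleftrightarrow> x \<in> set l"
      using r that Kr by (auto simp: nth_eq_iff_index_eq)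
    also have "\<dots> \<longleftrightarrow> x \<in> set (filter (\<lambda>x. x < K) l)" using that by simp
    finally show ?thesis using K(3) that by simp
  qed
  have "set (take (k - 1) r) = set (take K r) - set (s v)"
    using mem K(1) Kr by (auto simp flip: nth_image)
  also have "\<dots> = set r - targets s (set r) - set (s v)"
    using Cons.IH[OF K(2) r(1,2)] by simp
  finally have "set (take (k - 1) r) = set r - targets s (set vs)"
    by (auto simp: targets_def vs)
  moreover have "v \<notin> targets s (set vs)"
    using coded_targets[OF r(1)] r by (auto simp: targets_def vs)
  ultimately show ?case using k by (cases k) (auto simp: vs)
qed

text \<open>The new queue is described by the graph and the old queue alone, without the code: the
  freed vertices follow in the order of the outgoing edges.\<close>

lemma take_freed:
  assumes "valid K L" "coded s r L" "distinct r" "s v = map ((!) r) l" "\<forall>x\<in>set l. x < length r"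
    and "j \<le> K" "filter (\<lambda>x. x < K) l = [j..<K]"
  shows "take K r = take j r @ filter (\<lambda>x. x \<notin> targets s (set r)) (s v)"
proof -
  have K: "K \<le> length r" using valid_le_length[OF assms(1)] coded_length[OF assms(2)] by simp
  have "r ! x \<notin> targets s (set r) \<longleftrightarrow> x < K" if "x < length r" for x
  proof -
    have "r ! x \<notin> targets s (set r) \<longleftrightarrow> r ! x \<in> set (take K r)"
      using sources_of_valid[OF assms(1-3)] that by auto
    also have "\<dots> \<longleftrightarrow> x < K"
      using assms(3) that K by (auto simp: in_set_conv_nth nth_eq_iff_index_eq)
    finally show ?thesis .
  qed
  then have "filter (\<lambda>x. x \<notin> targets s (set r)) (s v) = map ((!) r) (filter (\<lambda>x. x < K) l)"
    using assms(5) by (auto simp: assms(4) filter_map o_def cong: filter_cong)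
  also have "\<dots> = drop j (take K r)"
    using K by (auto simp: assms(7) intro!: nth_equalityI)
  finally show ?thesis
    using append_take_drop_id[of j "take K r"] assms(6) by (simp add: min_def)
qed

text \<open>The queue determines the next vertex and, by \<open>take_freed\<close>, the next queue,
  so the two vertex orders agree step by step. As the common order has no repetitions, equal
  successor lists give equal positions.\<close>

lemma code_unique:
  "coded s vs L \<Longrightarrow> valid k L \<Longrightarrow> coded s ws L' \<Longrightarrow> valid k L' \<Longrightarrow> distinct vs \<Longrightarrow> distinct ws \<Longrightarrow>
     set vs = set ws \<Longrightarrow> take k vs = take k ws \<Longrightarrow> vs = ws \<and> L = L'"
proof (induction L arbitrary: k vs ws L')
  case Nil
  then have "vs = []" "ws = []" by (cases vs; auto)+
  with Nil show ?case by (cases L') auto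
next
  case (Cons l L)
  then obtain v r where vs: "vs = v # r" by (cases vs) auto
  with Cons.prems obtain w r' where ws: "ws = w # r'" by (cases ws) auto
  with Cons.prems obtain l' L'' where L': "L' = l' # L''" by (cases L') auto
  from Cons.prems vs ws have k: "0 < k" "w = v" "take (k - 1) r = take (k - 1) r'"
    by (cases k; auto)+
  with Cons.prems vs ws have sets: "set r = set r'" by auto
  from Cons.prems obtain K where K: "k - 1 \<le> K" "valid K L" "filter (\<lambda>x. x < K) l = [k - 1..<K]"
    by auto
  from Cons.prems L' obtain K' where
    K': "k - 1 \<le> K'" "valid K' L''" "filter (\<lambda>x. x < K') l' = [k - 1..<K']"
    by auto
  from Cons.prems vs have r: "coded s r L" "distinct r" "s v = map ((!) r) l"
    "\<forall>x\<in>set l. x < length r" by auto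
  from Cons.prems ws L' k have r': "coded s r' L''" "distinct r'" "s v = map ((!) r') l'"
    "\<forall>x\<in>set l'. x < length r'" by auto
  have takes: "take K r = take K' r'"
    using take_freed[OF K(2) r K(1,3)] take_freed[OF K'(2) r' K'(1,3)] k(3) sets by simp
  \<comment> \<open>Both prefixes have full length, so their equality also identifies
    \<open>K\<close> with \<open>K'\<close>.\<close>
  have "K \<le> length r" "K' \<le> length r'"
    using valid_le_length coded_length K(2) K'(2) r(1) r'(1) by metis+
  with takes have "K = K'" by (metis length_take min.absorb2)
  with takes Cons.IH[OF r(1) K(2) r'(1) _ r(2) r'(2) sets] K'(2) have rr: "r = r'" "L = L''"
    by auto
  have "l = l'"
  proof (rule map_inj_on)
    show "map ((!) r) l = map ((!) r) l'" using r(3) r'(3) rr by simp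
    show "inj_on ((!) r) (set l \<union> set l')"
      using r(2,4) r'(4) rr by (auto simp: inj_on_def nth_eq_iff_index_eq)
  qed
  with rr show ?case by (simp add: vs ws L' k)
qed

text \<open>This runs the removal process: the head of the queue is removed, the freed vertices are
  appended, and induction on the number of vertices handles the rest.\<close>

lemma code_exists:
  assumes "finite V" "\<And>v. v \<in> V \<Longrightarrow> distinct (s v) \<and> set (s v) \<subseteq> V"
    and "acyclic {(u, v). u \<in> V \<and> v \<in> set (s u)}"
    and "distinct ss" "set ss = V - targets s V"
  shows "\<exists>vs L. distinct vs \<and> set vs = V \<and> take (length ss) vs = ss \<and>
    coded s vs L \<and> valid (length ss) L"
  using assms
proof (induction "card V" arbitrary: V ss)
  case 0
  then have "V = {}" "ss = []" by auto
  then show ?case by (intro exI[of _ "[]"]) simp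
next
  case (Suc n)
  let ?E = "{(u, v). u \<in> V \<and> v \<in> set (s u)}"
  have "finite (V \<times> V)" using Suc.prems(1) by simp
  moreover have "?E \<subseteq> V \<times> V" using Suc.prems(2) by auto
  ultimately have "finite ?E" by (rule rev_finite_subset)
  then have "wf ?E" using Suc.prems(3) by (rule finite_acyclic_wf)
  have "V \<noteq> {}" using Suc.hyps(2) by auto
  \<comment> \<open>Acyclicity enters here: a minimal vertex has no incoming edge, so the queue
    cannot be empty.\<close>
  have "\<exists>z\<in>V. \<forall>y. (y, z) \<in> ?E \<longrightarrow> y \<notin> V"
    by (rule wfE_min'[OF \<open>wf ?E\<close> \<open>V \<noteq> {}\<close>]) blast
  then obtain z where "z \<in> V" "\<forall>y. (y, z) \<in> ?E \<longrightarrow> y \<notin> V" by blast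
  then have "z \<in> V" "z \<notin> targets s V" unfolding targets_def by blast+
  then have "z \<in> set ss" unfolding Suc.prems(5) by blast
  then obtain v ss' where ss: "ss = v # ss'" by (cases ss) auto
  have v: "v \<in> V" "v \<notin> targets s V" and ss': "set ss' \<subseteq> V" "set ss' \<inter> targets s V = {}"
    using Suc.prems(5) unfolding ss by auto
  define V' where "V' = V - {v}"
  have TV: "targets s V = set (s v) \<union> targets s V'"
    using v by (auto simp: targets_def V'_def)
  have V': "set (s u) \<subseteq> V'" if "u \<in> V" for u
    using that v Suc.prems(2) by (auto simp: targets_def V'_def)
  \<comment> \<open>The vertices whose only incoming edge comes from \<open>v\<close>, in the order
    of the edges of \<open>v\<close>.\<close>
  define new where "new = filter (\<lambda>x. x \<notin> targets s V') (s v)"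
  have acyc: "acyclic {(u, v). u \<in> V' \<and> v \<in> set (s u)}"
    by (rule acyclic_subset[OF Suc.prems(3)]) (auto simp: V'_def)
  have dist: "distinct (ss' @ new)"
    using Suc.prems(2,4) v ss ss' by (auto simp: new_def TV)
  have sset: "set (ss' @ new) = V' - targets s V'"
    using Suc.prems(4,5) V'[OF v(1)] by (auto simp: new_def TV ss V'_def)
  have "n = card V'" using Suc.hyps(2) v Suc.prems(1) by (simp add: V'_def)
  from Suc.hyps(1)[OF this _ _ acyc dist sset] Suc.prems(1,2) V'
  obtain r L where r: "distinct r" "set r = V'" "take (length (ss' @ new)) r = ss' @ new"
    "coded s r L" "valid (length (ss' @ new)) L"
    by (auto simp: V'_def)
  define K where "K = length (ss' @ new)"
  note Kle = valid_le_length[OF r(5), unfolded coded_length[OF r(4)], folded K_def]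
  have "\<forall>x\<in>set (s v). \<exists>j. j < length r \<and> r ! j = x"
    using V'[OF v(1)] r(2) by (metis in_set_conv_nth subsetD)
  \<comment> \<open>\<open>g\<close> looks up positions in the remaining vertex list, which turns
    successors into code entries.\<close>
  then obtain g where g: "\<forall>x\<in>set (s v). g x < length r \<and> r ! (g x) = x" by metis
  define l where "l = map g (s v)"
  have l: "s v = map ((!) r) l" "\<forall>x\<in>set l. x < length r"
    using g by (auto simp: l_def map_idI)
  have "distinct l" using Suc.prems(2)[OF v(1)] l(1) by (metis distinct_map)
  \<comment> \<open>An entry below \<open>length ss'\<close> would be an edge into a vertex that is
    already a source.\<close>
  have low: "length ss' \<le> x" if "x \<in> set l" for x
  proof (rule ccontr)
    assume "\<not> length ss' \<le> x"
    then have "take K r ! x = ss' ! x" "x < K"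
      unfolding r(3)[folded K_def] by (auto simp: nth_append K_def)
    then have "r ! x \<in> set ss'" using \<open>\<not> length ss' \<le> x\<close> by simp
    moreover have "r ! x \<in> targets s V" using that by (simp add: TV l(1))
    ultimately show False using ss' by blast
  qed
  have mem: "r ! x \<notin> targets s V' \<longleftrightarrow> x < K" if "x < length r" for x
  proof -
    have "r ! x \<notin> targets s V' \<longleftrightarrow> r ! x \<in> set (take K r)"
      using that r(2) unfolding K_def r(3) sset by auto
    also have "\<dots> \<longleftrightarrow> x < K"
      using r(1) that Kle by (auto simp: in_set_conv_nth nth_eq_iff_index_eq)
    finally show ?thesis .
  qed
  have "filter (\<lambda>x. x < K) l = [length ss'..<K]"
  proof (rule map_inj_on)
    have "map ((!) r) (filter (\<lambda>x. x < K) l) = new"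
      using mem l(2) by (auto simp: new_def l(1) filter_map o_def cong: filter_cong)
    also have "\<dots> = drop (length ss') (take K r)" using r(3) by (simp add: K_def)
    also have "\<dots> = map ((!) r) [length ss'..<K]"
      using Kle by (auto intro!: nth_equalityI)
    finally show "map ((!) r) (filter (\<lambda>x. x < K) l) = map ((!) r) [length ss'..<K]" .
    show "inj_on ((!) r) (set (filter (\<lambda>x. x < K) l) \<union> set [length ss'..<K])"
      using r(1) l(2) Kle by (auto simp: inj_on_def nth_eq_iff_index_eq)
  qed
  then have "valid (length ss) (l # L)"
    using \<open>distinct l\<close> low l(2) r(5) coded_length[OF r(4)]
    by (auto simp: ss K_def intro!: exI[of _ "length ss' + length new"])
  moreover have "coded s (v # r) (l # L)" using l r(4) by simp
  moreover have "take (length ss) (v # r) = ss"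
    using arg_cong[OF r(3), of "take (length ss')"] by (simp add: ss min_def)
  moreover have "distinct (v # r)" "set (v # r) = V" using r(1,2) v by (auto simp: V'_def)
  ultimately show ?case by blast
qed


section \<open>Ordered lists of sources and successors\<close>

lemma sorted_by_map:
  assumes "sorted_by R xs"
    and "\<And>x y. x \<in> set xs \<Longrightarrow> y \<in> set xs \<Longrightarrow> (x, y) \<in> R \<Longrightarrow> (f x, f y) \<in> Q"
  shows "sorted_by Q (map f xs)"
  using assms by (induction xs) auto

definition successors :: "'a doag \<Rightarrow> 'a \<Rightarrow> 'a set" where
  "successors G v = {w. (v, w) \<in> edges G}"

definition succ_order :: "'a doag \<Rightarrow> 'a \<Rightarrow> 'a rel" where
  "succ_order G v = {(x, y). ((v, x), (v, y)) \<in> out_ord G v}"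

definition succs :: "'a doag \<Rightarrow> 'a \<Rightarrow> 'a list" where
  "succs G v = ordered_list (successors G v) (succ_order G v)"

definition srcs :: "'a doag \<Rightarrow> 'a list" where
  "srcs G = ordered_list (sources G) (src_ord G)"

lemma out_edges_eq: "out_edges G v = Pair v ` successors G v"
  by (auto simp: out_edges_def successors_def)

lemma succ_order:
  assumes "is_doag G" "v \<in> verts G"
  shows "finite (successors G v)" "successors G v \<subseteq> verts G"
    "strict_linear_order_on (successors G v) (succ_order G v)"
proof -
  show "successors G v \<subseteq> verts G"
    using assms by (auto simp: is_doag_def successors_def)
  then show "finite (successors G v)"
    using assms finite_subset by (auto simp: is_doag_def)
  have "strict_linear_order_on (out_edges G v) (out_ord G v)"
    using assms by (auto simp: is_doag_def)
  then show "strict_linear_order_on (successors G v) (succ_order G v)"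
    unfolding strict_linear_order_on_def out_edges_eq
    by (auto simp: succ_order_def trans_def irrefl_def total_on_def)
qed

lemma succs:
  assumes "is_doag G" "v \<in> verts G"
  shows "set (succs G v) = successors G v" "sorted_by (succ_order G v) (succs G v)"
    "distinct (succs G v)"
  unfolding succs_def using ordered_list succ_order[OF assms] by metis+

lemma src_order:
  assumes "is_doag G"
  shows "finite (sources G)" "strict_linear_order_on (sources G) (src_ord G)"
  using assms by (auto simp: is_doag_def sources_def)

lemma srcs:
  assumes "is_doag G"
  shows "set (srcs G) = sources G" "sorted_by (src_ord G) (srcs G)" "distinct (srcs G)"
  unfolding srcs_def using ordered_list src_order[OF assms] by metis+

lemma edge_iff_succs:
  "is_doag G \<Longrightarrow> u \<in> verts G \<Longrightarrow> (u, v) \<in> edges G \<longleftrightarrow> v \<in> set (succs G u)"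
  by (simp add: succs successors_def)

lemma edges_eq_Sigma:
  assumes "is_doag G"
  shows "edges G = (SIGMA v:verts G. set (succs G v))"
  using assms edge_iff_succs[OF assms] by (fastforce simp: is_doag_def)

lemma sources_eq_targets:
  assumes "is_doag G"
  shows "sources G = verts G - targets (succs G) (verts G)"
  using edges_eq_Sigma[OF assms] by (auto simp: sources_def targets_def)

text \<open>Forward, the image of a sorted list is sorted and enumerates the right set, so it is the
  ordered list there. Backward, edges are memberships in these lists and the orders compare
  positions in them, so list equality and injectivity recover both.\<close>

lemma doag_iso_iff_lists:
  assumes G: "is_doag G" and H: "is_doag H"
  shows "doag_iso G H \<longleftrightarrow> (\<exists>f. bij_betw f (verts G) (verts H) \<and>
    (\<forall>v\<in>verts G. succs H (f v) = map f (succs G v)) \<and> srcs H = map f (srcs G))"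
proof
  assume "doag_iso G H"
  then obtain f where f: "bij_betw f (verts G) (verts H)"
    and E: "\<And>u v. u \<in> verts G \<Longrightarrow> v \<in> verts G \<Longrightarrow> (u, v) \<in> edges G \<longleftrightarrow> (f u, f v) \<in> edges H"
    and O: "\<And>v e e'. v \<in> verts G \<Longrightarrow> e \<in> out_edges G v \<Longrightarrow> e' \<in> out_edges G v \<Longrightarrow>
      (e, e') \<in> out_ord G v \<longleftrightarrow> (map_prod f f e, map_prod f f e') \<in> out_ord H (f v)"
    and S: "\<And>u v. u \<in> sources G \<Longrightarrow> v \<in> sources G \<Longrightarrow>
      (u, v) \<in> src_ord G \<longleftrightarrow> (f u, f v) \<in> src_ord H"
    unfolding doag_iso_def by blast
  have fin: "f v \<in> verts H" if "v \<in> verts G" for v using bij_betwE[OF f] that by blast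
  have imgE: "\<exists>u\<in>verts G. w = f u" if "w \<in> verts H" for w
    using bij_betw_imp_surj_on[OF f] that by blast
  have EG: "edges G \<subseteq> verts G \<times> verts G" and EH: "edges H \<subseteq> verts H \<times> verts H"
    using G H by (auto simp: is_doag_def)
  have "succs H (f v) = map f (succs G v)" if v: "v \<in> verts G" for v
    unfolding succs_def[of H]
  proof (rule ordered_list_eqI[OF succ_order(3)[OF H fin[OF v]]])
    have "successors H (f v) = f ` successors G v"
    proof (intro equalityI subsetI)
      fix w assume w: "w \<in> successors H (f v)"
      then have "w \<in> verts H" using EH unfolding successors_def by blast
      then obtain u where u: "u \<in> verts G" "w = f u" using imgE by blast
      with w E[OF v u(1)] show "w \<in> f ` successors G v" by (simp add: successors_def)
    next
      fix w assume "w \<in> f ` successors G v"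
      then obtain u where u: "(v, u) \<in> edges G" "w = f u" by (auto simp: successors_def)
      then have "u \<in> verts G" using EG by blast
      from E[OF v this] u show "w \<in> successors H (f v)" by (simp add: successors_def)
    qed
    then show "set (map f (succs G v)) = successors H (f v)"
      using succs(1)[OF G v] by simp
    have "(f x, f y) \<in> succ_order H (f v)"
      if "x \<in> successors G v" "y \<in> successors G v" "(x, y) \<in> succ_order G v" for x y
      using O[OF v, of "(v, x)" "(v, y)"] that by (simp add: out_edges_eq succ_order_def)
    then show "sorted_by (succ_order H (f v)) (map f (succs G v))"
      by (intro sorted_by_map[OF succs(2)[OF G v]]) (simp add: succs(1)[OF G v])
  qed
  moreover have "srcs H = map f (srcs G)"
    unfolding srcs_def[of H]
  proof (rule ordered_list_eqI[OF src_order(2)[OF H]])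
    have "sources H = f ` sources G"
    proof (intro equalityI subsetI)
      fix w assume w: "w \<in> sources H"
      then obtain u where u: "u \<in> verts G" "w = f u" using imgE by (auto simp: sources_def)
      have "(x, u) \<notin> edges G" for x
      proof
        assume "(x, u) \<in> edges G"
        moreover from this have "x \<in> verts G" using EG by blast
        ultimately have "(f x, w) \<in> edges H" using E u by simp
        with w show False by (simp add: sources_def)
      qed
      with u show "w \<in> f ` sources G" by (simp add: sources_def)
    next
      fix w assume "w \<in> f ` sources G"
      then obtain u where u: "u \<in> verts G" "w = f u" "\<And>x. (x, u) \<notin> edges G"
        by (auto simp: sources_def)
      have "(y, w) \<notin> edges H" for y
      proof
        assume y: "(y, w) \<in> edges H"
        then have "y \<in> verts H" using EH by blast
        then obtain x where "x \<in> verts G" "y = f x" using imgE by blast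
        with E[OF this(1) u(1)] y u show False by simp
      qed
      with u(1,2) fin[OF u(1)] show "w \<in> sources H" by (simp add: sources_def)
    qed
    then show "set (map f (srcs G)) = sources H" using srcs(1)[OF G] by simp
    show "sorted_by (src_ord H) (map f (srcs G))"
      by (intro sorted_by_map[OF srcs(2)[OF G]]) (simp add: srcs(1)[OF G] S)
  qed
  ultimately show "\<exists>f. bij_betw f (verts G) (verts H) \<and>
    (\<forall>v\<in>verts G. succs H (f v) = map f (succs G v)) \<and> srcs H = map f (srcs G)"
    using f by blast
next
  assume "\<exists>f. bij_betw f (verts G) (verts H) \<and>
    (\<forall>v\<in>verts G. succs H (f v) = map f (succs G v)) \<and> srcs H = map f (srcs G)"
  then obtain f where f: "bij_betw f (verts G) (verts H)"
    and succ: "\<And>v. v \<in> verts G \<Longrightarrow> succs H (f v) = map f (succs G v)"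
    and src: "srcs H = map f (srcs G)" by blast
  have inj: "inj_on f (verts G)" using f by (rule bij_betw_imp_inj_on)
  have fin: "f v \<in> verts H" if "v \<in> verts G" for v using bij_betwE[OF f] that by blast
  have "(u, v) \<in> edges G \<longleftrightarrow> (f u, f v) \<in> edges H" if "u \<in> verts G" "v \<in> verts G" for u v
  proof -
    have "set (succs G u) \<subseteq> verts G" using succs(1)[OF G] succ_order(2)[OF G] that by blast
    then have "f v \<in> set (succs H (f u)) \<longleftrightarrow> v \<in> set (succs G u)"
      using inj_on_image_mem_iff[OF inj] that by (simp add: succ)
    then show ?thesis
      using edge_iff_succs[OF G that(1)] edge_iff_succs[OF H fin[OF that(1)]] by simp
  qed
  moreover have "(e, e') \<in> out_ord G v \<longleftrightarrow> (map_prod f f e, map_prod f f e') \<in> out_ord H (f v)"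
    if v: "v \<in> verts G" and e: "e \<in> out_edges G v" "e' \<in> out_edges G v" for v e e'
  proof -
    obtain x y where xy: "e = (v, x)" "e' = (v, y)" "x \<in> successors G v" "y \<in> successors G v"
      using e unfolding out_edges_eq by blast
    have "(x, y) \<in> succ_order G v \<longleftrightarrow> (f x, f y) \<in> succ_order H (f v)"
      by (rule ordered_list_map_iff[OF succ_order(1,3)[OF G v] succ_order(1,3)[OF H fin[OF v]]
            succ[OF v, unfolded succs_def] xy(3,4)])
    then show ?thesis by (simp add: succ_order_def xy)
  qed
  moreover have "(u, v) \<in> src_ord G \<longleftrightarrow> (f u, f v) \<in> src_ord H"
    if "u \<in> sources G" "v \<in> sources G" for u v
    by (rule ordered_list_map_iff[OF src_order[OF G] src_order[OF H] src[unfolded srcs_def] that])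
  ultimately show "doag_iso G H" unfolding doag_iso_def using f by blast
qed

section \<open>Codes as complete isomorphism invariants\<close>

definition has_code :: "'a doag \<Rightarrow> nat list list \<Rightarrow> bool" where
  "has_code G L \<longleftrightarrow> (\<exists>vs. distinct vs \<and> set vs = verts G \<and> take (length (srcs G)) vs = srcs G \<and>
     coded (succs G) vs L \<and> valid (length (srcs G)) L)"

lemma has_code_exists: "is_doag G \<Longrightarrow> \<exists>L. has_code G L"
proof -
  assume G: "is_doag G"
  have "{(u, v). u \<in> verts G \<and> v \<in> set (succs G u)} = edges G"
    using edges_eq_Sigma[OF G] by auto
  then have "acyclic {(u, v). u \<in> verts G \<and> v \<in> set (succs G u)}"
    using G by (simp add: is_doag_def)
  moreover have "finite (verts G)" using G by (simp add: is_doag_def)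
  moreover have "distinct (succs G v) \<and> set (succs G v) \<subseteq> verts G" if "v \<in> verts G" for v
    using succs(1,3)[OF G that] succ_order(2)[OF G that] by simp
  moreover have "set (srcs G) = verts G - targets (succs G) (verts G)"
    using srcs(1)[OF G] sources_eq_targets[OF G] by simp
  ultimately show ?thesis
    using code_exists[of "verts G" "succs G" "srcs G"] srcs(3)[OF G]
    unfolding has_code_def by blast
qed

lemma has_code_unique: "has_code G L \<Longrightarrow> has_code G L' \<Longrightarrow> L = L'"
  unfolding has_code_def using code_unique by metis

text \<open>The bijection carries a canonical vertex order to a canonical vertex order with the same
  positions.\<close>

lemma has_code_iso:
  assumes "is_doag G" "is_doag H" "doag_iso G H" "has_code G L"
  shows "has_code H L"
proof -
  obtain f where f: "bij_betw f (verts G) (verts H)"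
    "\<And>v. v \<in> verts G \<Longrightarrow> succs H (f v) = map f (succs G v)" "srcs H = map f (srcs G)"
    using assms(3) doag_iso_iff_lists[OF assms(1,2)] by blast
  from assms(4) obtain vs where vs: "distinct vs" "set vs = verts G"
    "take (length (srcs G)) vs = srcs G" "coded (succs G) vs L" "valid (length (srcs G)) L"
    unfolding has_code_def by blast
  have "coded (succs H) (map f vs) L" using coded_map[OF vs(4)] f(2) vs(2) by blast
  moreover have "distinct (map f vs)" "set (map f vs) = verts H"
    using f(1) vs(1,2) by (auto simp: distinct_map bij_betw_def)
  moreover have "take (length (srcs H)) (map f vs) = srcs H"
    using vs(3) f(3) by (simp add: take_map)
  ultimately show ?thesis
    unfolding has_code_def using vs(5) f(3) by (metis length_map)
qed

text \<open>Vertices at equal positions of the two canonical orders are matched. The code prescribes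
  the same lists on both sides and, by \<open>valid_unique\<close>, the same number of
  sources.\<close>

lemma iso_if_same_code:
  assumes G: "is_doag G" and H: "is_doag H" and "has_code G L" "has_code H L"
  shows "doag_iso G H"
proof -
  from assms(3) obtain vs where vs: "distinct vs" "set vs = verts G"
    "take (length (srcs G)) vs = srcs G" "coded (succs G) vs L" "valid (length (srcs G)) L"
    unfolding has_code_def by blast
  from assms(4) obtain ws where ws: "distinct ws" "set ws = verts H"
    "take (length (srcs H)) ws = srcs H" "coded (succs H) ws L" "valid (length (srcs H)) L"
    unfolding has_code_def by blast
  have len: "length vs = length ws" using coded_length vs(4) ws(4) by metis
  have k: "length (srcs G) = length (srcs H)" using valid_unique vs(5) ws(5) by metis
  define f where "f v = ws ! (THE i. i < length vs \<and> vs ! i = v)" for v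
  have f: "f (vs ! i) = ws ! i" if "i < length vs" for i
    unfolding f_def using vs(1) that by (intro arg_cong[of _ _ "(!) ws"] the_equality)
      (auto simp: nth_eq_iff_index_eq)
  have map_f: "map f vs = ws" using f len by (auto intro!: nth_equalityI)
  have "bij_betw f (verts G) (verts H)"
    using vs(1,2) ws(1,2) map_f by (metis bij_betw_def distinct_map set_map)
  moreover have "succs H (f v) = map f (succs G v)" if v: "v \<in> verts G" for v
  proof -
    obtain i where i: "i < length vs" "v = vs ! i" using v vs(2) by (metis in_set_conv_nth)
    show ?thesis
      using coded_nth[OF vs(4) i(1)] coded_nth[OF ws(4), of i] i len f by auto
  qed
  moreover have "srcs H = map f (srcs G)"
    using vs(3) ws(3) map_f k by (metis take_map)
  ultimately show ?thesis using doag_iso_iff_lists[OF G H] by blast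
qed

lemma has_code_cards:
  assumes G: "is_doag G" and "has_code G L"
  shows "length L = card (verts G)" "sum_list (map length L) = card (edges G)"
    "valid (card (sources G)) L"
proof -
  from assms(2) obtain vs where vs: "distinct vs" "set vs = verts G"
    "coded (succs G) vs L" "valid (length (srcs G)) L"
    unfolding has_code_def by blast
  show "length L = card (verts G)" using coded_length[OF vs(3)] vs(1,2) distinct_card by metis
  show "valid (card (sources G)) L" using vs(4) srcs(1,3)[OF G] by (metis distinct_card)
  have "card (edges G) = (\<Sum>v\<in>verts G. card (set (succs G v)))"
    unfolding edges_eq_Sigma[OF G] using G by (auto simp: is_doag_def)
  also have "\<dots> = (\<Sum>v\<in>set vs. length (succs G v))"
    using succs(3)[OF G] vs(2) by (intro sum.cong) (auto simp: distinct_card)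
  also have "\<dots> = sum_list (map length L)"
    using coded_sum_list[OF vs(3)] vs(1) by (simp add: sum_list_distinct_conv_sum_set)
  finally show "sum_list (map length L) = card (edges G)" by simp
qed

text \<open>With vertices numbered in canonical order, position \<open>x\<close> in the rest after
  \<open>u\<close> is the vertex \<open>Suc u + x\<close>.\<close>

lemma coded_upt:
  assumes "valid k L" "j \<le> length L"
    and "\<And>u. u < length L \<Longrightarrow> s u = map (\<lambda>x. Suc u + x) (L ! u)"
  shows "coded s [j..<length L] (drop j L)"
  using assms(2)
proof (induction j rule: inc_induct)
  case (step j)
  have "\<forall>x\<in>set (L ! j). Suc (j + x) < length L" using valid_nth[OF assms(1) step(2)] by auto
  with step show ?case
    using assms(3)[OF step(2)] by (auto simp: upt_conv_Cons Cons_nth_drop_Suc[symmetric])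
qed simp

text \<open>The vertices are the numbers below \<open>length L\<close> in their natural order. All
  edges go upwards, which gives acyclicity, and \<open>sources_of_valid\<close> identifies the
  sources as the first \<open>k\<close> vertices.\<close>

lemma code_realized:
  assumes "valid k L"
  shows "\<exists>G :: nat doag. is_doag G \<and> has_code G L"
proof -
  define n where "n = length L"
  define t where "t u = map (\<lambda>x. Suc u + x) (L ! u)" for u
  define G where "G = \<lparr>verts = {..<n}, edges = (SIGMA u:{..<n}. set (t u)),
    out_ord = (\<lambda>u. position_order (map (Pair u) (t u))), src_ord = position_order [0..<k]\<rparr>"
  have k: "k \<le> n" using valid_le_length[OF assms] by (simp add: n_def)
  have t: "distinct (t u)" "set (t u) \<subseteq> {Suc u..<n}" if "u < n" for u
    using valid_nth[OF assms, of u] that by (auto simp: t_def n_def distinct_map inj_on_def)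
  have "coded t [0..<length L] (drop 0 L)" by (rule coded_upt[OF assms]) (auto simp: t_def)
  then have cod: "coded t [0..<n] L" by (simp add: n_def)
  have "set (take k [0..<n]) = {..<n} - targets t {..<n}"
    using sources_of_valid[OF assms cod] by (simp add: atLeast0LessThan)
  then have "{..<n} - targets t {..<n} = {..<k}" using k by (simp add: take_upt atLeast0LessThan)
  moreover have "sources G = {..<n} - targets t {..<n}"
    by (auto simp: sources_def G_def targets_def)
  ultimately have src: "sources G = set [0..<k]"
    by (simp only: atLeast_upt)
  have out: "out_edges G u = set (map (Pair u) (t u))" if "u < n" for u
    using that by (auto simp: out_edges_def G_def)
  have dist: "distinct (map (Pair u) (t u))" if "u < n" for u
    using t[OF that] by (simp add: distinct_map inj_on_def)
  have edges: "u < n \<and> u < v \<and> v < n" if "(u, v) \<in> edges G" for u v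
    using that t(2)[of u] by (auto simp: G_def)
  then have "edges G \<subseteq> less_than" "edges G \<subseteq> verts G \<times> verts G" by (auto simp: G_def)
  moreover from this have "acyclic (edges G)"
    using acyclic_subset[OF wf_acyclic[OF wf_less_than]] by blast
  moreover have "out_ord G u \<subseteq> out_edges G u \<times> out_edges G u \<and>
      strict_linear_order_on (out_edges G u) (out_ord G u)" if "u < n" for u
    using position_order(1,2)[OF dist[OF that]] unfolding out[OF that] by (simp add: G_def)
  moreover have "src_ord G \<subseteq> sources G \<times> sources G \<and>
      strict_linear_order_on (sources G) (src_ord G)"
    using position_order(1,2)[OF distinct_upt, of 0 k] unfolding src by (simp add: G_def)
  ultimately have G: "is_doag G" unfolding is_doag_def by (simp add: G_def)
  have "srcs G = [0..<k]"
    unfolding srcs_def using position_order[OF distinct_upt, of 0 k] src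
    by (intro ordered_list_eqI) (auto simp: G_def)
  moreover have succ: "succs G u = t u" if u: "u < n" for u
    unfolding succs_def
  proof (rule ordered_list_eqI[OF succ_order(3)[OF G]])
    show "u \<in> verts G" using u by (simp add: G_def)
    show "set (t u) = successors G u" using u by (auto simp: successors_def G_def)
    show "sorted_by (succ_order G u) (t u)"
      using position_order(3)[OF dist[OF u]] by (simp add: succ_order_def G_def sorted_wrt_map)
  qed
  \<comment> \<open>Relabelling by \<open>id\<close> exchanges \<open>t\<close> for the successor
    lists of \<open>G\<close>, which agree with it on the vertices.\<close>
  moreover have "coded (succs G) (map id [0..<n]) L"
    by (rule coded_map[OF cod]) (simp add: succ)
  ultimately have "has_code G L"
    unfolding has_code_def using assms k
    by (intro exI[of _ "[0..<n]"]) (auto simp: G_def take_upt)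
  with G show ?thesis by blast
qed

section \<open>The number of isomorphism classes\<close>

definition codes :: "nat \<Rightarrow> nat \<Rightarrow> nat \<Rightarrow> nat list list set" where
  "codes n m k = {L. length L = n \<and> sum_list (map length L) = m \<and> valid k L}"

text \<open>The classes are the nonempty fibres of \<open>f\<close>, so they correspond to its
  values on \<open>A\<close>.\<close>

lemma card_quotient_kernel:
  "card (A // {(x, y). x \<in> A \<and> y \<in> A \<and> f x = f y}) = card (f ` A)"
proof -
  let ?g = "\<lambda>b. {x \<in> A. f x = b}"
  let ?r = "{(x, y). x \<in> A \<and> y \<in> A \<and> f x = f y}"
  have "A // ?r = (\<lambda>x. ?r `` {x}) ` A" by (auto simp: quotient_def)
  also have "\<dots> = (\<lambda>x. ?g (f x)) ` A" by (rule image_cong) auto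
  finally have "A // ?r = ?g ` f ` A" by (simp add: image_image)
  moreover have "inj_on ?g (f ` A)" by (auto simp: inj_on_def)
  ultimately show ?thesis by (simp add: card_image)
qed

text \<open>Isomorphism is equality of codes, and by \<open>code_realized\<close> every valid list
  of lists occurs as a code.\<close>

lemma num_doags_eq_card_codes: "num_doags n m k = card (codes n m k)"
proof -
  define code :: "nat doag \<Rightarrow> nat list list" where "code G = (THE L. has_code G L)" for G
  have code: "has_code G (code G)" if "is_doag G" for G
  proof -
    have "\<exists>!L. has_code G L" using has_code_exists[OF that] has_code_unique by blast
    then show ?thesis unfolding code_def by (rule theI')
  qed
  have code_eqI: "code G = L" if "is_doag G" "has_code G L" for G L
    using code[OF that(1)] that(2) by (rule has_code_unique)
  have "doag_iso G H \<longleftrightarrow> code G = code H" if G: "is_doag G" and H: "is_doag H" for G H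
  proof
    assume "doag_iso G H"
    from has_code_iso[OF G H this code[OF G]] show "code G = code H"
      using code_eqI[OF H] by simp
  next
    assume "code G = code H"
    then show "doag_iso G H" using iso_if_same_code[OF G H code[OF G]] code[OF H] by simp
  qed
  then have "{(G, H). G \<in> doags n m k \<and> H \<in> doags n m k \<and> doag_iso G H} =
    {(G, H). G \<in> doags n m k \<and> H \<in> doags n m k \<and> code G = code H}"
    by (auto simp: doags_def)
  moreover have "code ` doags n m k = codes n m k"
  proof (intro equalityI subsetI)
    fix L assume "L \<in> code ` doags n m k"
    then obtain G where "is_doag G" "L = code G" "G \<in> doags n m k" by (auto simp: doags_def)
    then show "L \<in> codes n m k"
      using has_code_cards[OF _ code] by (auto simp: doags_def codes_def)
  next
    fix L assume L: "L \<in> codes n m k"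
    then obtain G :: "nat doag" where G: "is_doag G" "has_code G L"
      using code_realized by (auto simp: codes_def)
    with L have "G \<in> doags n m k"
      using has_code_cards[OF G] valid_unique by (auto simp: doags_def codes_def)
    then show "L \<in> code ` doags n m k" using code_eqI[OF G] by blast
  qed
  ultimately show ?thesis unfolding num_doags_def by (simp add: card_quotient_kernel)
qed


section \<open>Counting codes\<close>

definition shuffles_with :: "'a list \<Rightarrow> 'a set \<Rightarrow> nat \<Rightarrow> 'a list set" where
  "shuffles_with xs A i = {l. distinct l \<and> length l = length xs + i \<and> set l \<subseteq> set xs \<union> A \<and>
     filter (\<lambda>x. x \<in> set xs) l = xs}"

fun weave :: "nat \<Rightarrow> nat \<Rightarrow> nat \<Rightarrow> nat" where
  "weave a q 0 = 1"
| "weave a 0 (Suc i) = a * weave (a - 1) 0 i"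
| "weave a (Suc q) (Suc i) = weave a q (Suc i) + a * weave (a - 1) (Suc q) i"

lemma finite_shuffles_with: "finite A \<Longrightarrow> finite (shuffles_with xs A i)"
  by (rule finite_subset[OF _ finite_lists_length_eq[of "set xs \<union> A" "length xs + i"]])
     (auto simp: shuffles_with_def)

lemma shuffles_with_0:
  assumes "distinct xs" "set xs \<inter> A = {}"
  shows "shuffles_with xs A 0 = {xs}"
proof -
  have "l = xs" if "length l = length xs" "filter (\<lambda>x. x \<in> set xs) l = xs" for l
    using that by (metis filter_id_conv filter_True length_filter_less nat_neq_iff)
  then show ?thesis using assms by (auto simp: shuffles_with_def)
qed

text \<open>Split by the first entry: either the head of \<open>xs\<close>, whose order is
  prescribed, or any element of \<open>A\<close>, which is then used up. These are the two terms in
  the recursion of \<open>weave\<close>.\<close>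

lemma shuffles_with_Suc:
  assumes "distinct xs" "set xs \<inter> A = {}"
  shows "shuffles_with xs A (Suc i) =
    (if xs = [] then {} else (#) (hd xs) ` shuffles_with (tl xs) A (Suc i)) \<union>
    (\<Union>y\<in>A. (#) y ` shuffles_with xs (A - {y}) i)" (is "_ = ?R")
proof (intro equalityI subsetI)
  fix l assume l: "l \<in> shuffles_with xs A (Suc i)"
  then obtain y r where yr: "l = y # r" by (cases l) (auto simp: shuffles_with_def)
  show "l \<in> ?R"
  proof (cases "y \<in> A")
    case True
    then have "y \<notin> set xs" using assms by auto
    then have "r \<in> shuffles_with xs (A - {y}) i"
      using l by (auto simp: shuffles_with_def yr)
    with True show ?thesis by (auto simp: yr)
  next
    case False
    then have "y \<in> set xs" using l by (auto simp: shuffles_with_def yr)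
    with l obtain xs' where xs: "xs = y # xs'" "filter (\<lambda>x. x \<in> set xs) r = xs'"
      by (cases xs) (auto simp: shuffles_with_def yr)
    have "y \<notin> set r" using l by (auto simp: shuffles_with_def yr)
    then have "filter (\<lambda>x. x \<in> set xs') r = filter (\<lambda>x. x \<in> set xs) r"
      by (intro filter_cong) (auto simp: xs(1))
    then have "r \<in> shuffles_with xs' A (Suc i)"
      using l xs(2) \<open>y \<notin> set r\<close> by (auto simp: shuffles_with_def yr xs(1))
    then show ?thesis by (simp add: yr xs(1))
  qed
next
  fix l assume "l \<in> ?R"
  then consider (hd) x xs' r where "xs = x # xs'" "l = x # r" "r \<in> shuffles_with xs' A (Suc i)"
    | (new) y r where "y \<in> A" "l = y # r" "r \<in> shuffles_with xs (A - {y}) i"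
    by (cases xs) (auto split: if_splits)
  then show "l \<in> shuffles_with xs A (Suc i)"
  proof cases
    case hd
    then have "x \<notin> set r" using assms by (auto simp: shuffles_with_def)
    then have "filter (\<lambda>x. x \<in> set xs) r = filter (\<lambda>x. x \<in> set xs') r"
      by (intro filter_cong) (auto simp: hd(1))
    with hd \<open>x \<notin> set r\<close> show ?thesis by (auto simp: shuffles_with_def)
  next
    case new
    then have "y \<notin> set r" "y \<notin> set xs" using assms by (auto simp: shuffles_with_def)
    with new show ?thesis by (auto simp: shuffles_with_def)
  qed
qed

lemma card_shuffles_with:
  assumes "finite A" "distinct xs" "set xs \<inter> A = {}"
  shows "card (shuffles_with xs A i) = weave (card A) (length xs) i"
  using assms
proof (induction "length xs + i" arbitrary: xs A i)
  case 0
  then show ?case by (simp add: shuffles_with_0)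
next
  case (Suc n)
  show ?case
  proof (cases i)
    case 0
    with Suc.prems show ?thesis by (simp add: shuffles_with_0)
  next
    case (Suc j)
    let ?N = "\<Union>y\<in>A. (#) y ` shuffles_with xs (A - {y}) j"
    have inj: "inj_on ((#) y) B" for y :: 'a and B by (simp add: inj_on_def)
    have "card ?N = (\<Sum>y\<in>A. card ((#) y ` shuffles_with xs (A - {y}) j))"
      using Suc.prems(1) by (intro card_UN_disjoint) (auto simp: finite_shuffles_with)
    \<comment> \<open>The summands do not depend on the chosen element, which produces the factor
      \<open>card A\<close>.\<close>
    also have "\<dots> = (\<Sum>y\<in>A. weave (card A - 1) (length xs) j)"
    proof (rule sum.cong[OF refl])
      fix y assume "y \<in> A"
      have "card (shuffles_with xs (A - {y}) j) = weave (card (A - {y})) (length xs) j"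
        by (rule Suc.hyps(1)) (use Suc.hyps(2) Suc.prems \<open>i = Suc j\<close> in auto)
      then show "card ((#) y ` shuffles_with xs (A - {y}) j) = weave (card A - 1) (length xs) j"
        using \<open>y \<in> A\<close> Suc.prems(1) by (simp add: card_image[OF inj])
    qed
    finally have new: "card ?N = card A * weave (card A - 1) (length xs) j" by simp
    show ?thesis
    proof (cases xs)
      case Nil
      then show ?thesis using new shuffles_with_Suc[OF Suc.prems(2,3), of j] Suc by simp
    next
      case (Cons x xs')
      have "card (shuffles_with xs' A i) = weave (card A) (length xs') i"
        by (rule Suc.hyps(1)) (use Suc.hyps(2) Suc.prems Cons in auto)
      then have old: "card ((#) x ` shuffles_with xs' A i) = weave (card A) (length xs') i"
        by (simp add: card_image[OF inj])
      have "card (shuffles_with xs A i) = card ((#) x ` shuffles_with xs' A i \<union> ?N)"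
        using shuffles_with_Suc[OF Suc.prems(2,3), of j] Cons Suc by simp
      also have "\<dots> = card ((#) x ` shuffles_with xs' A i) + card ?N"
        using Suc.prems Cons by (intro card_Un_disjoint) (auto simp: finite_shuffles_with)
      finally show ?thesis using old new Cons Suc by simp
    qed
  qed
qed

text \<open>Here \<open>n\<close> and \<open>k\<close> count the vertices and sources apart from the
  removed source, and \<open>k + q\<close> is the queue length afterwards. The guard keeps the
  truncated subtraction \<open>m - q - i\<close> from admitting spurious codes.\<close>

definition code_steps :: "nat \<Rightarrow> nat \<Rightarrow> nat \<Rightarrow> nat \<Rightarrow> nat \<Rightarrow> nat list list set" where
  "code_steps n m k q i = (if q + i \<le> m \<and> k + q \<le> n
     then (\<lambda>(l, L). l # L) `
       (shuffles_with [k..<k + q] {k + q..<n} i \<times> codes n (m - q - i) (k + q))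
     else {})"

lemma in_code_steps:
  "l # L \<in> code_steps n m k q i \<longleftrightarrow>
    q + i \<le> m \<and> k + q \<le> n \<and> L \<in> codes n (m - q - i) (k + q) \<and> distinct l \<and>
    length l = q + i \<and> set l \<subseteq> {k..<n} \<and> filter (\<lambda>x. x < k + q) l = [k..<k + q]"
proof (cases "k + q \<le> n")
  case True
  then have "{k..<k + q} \<union> {k + q..<n} = {k..<n}" by auto
  moreover have "filter (\<lambda>x. x \<in> {k..<k + q}) l = filter (\<lambda>x. x < k + q) l"
    if "set l \<subseteq> {k..<n}"
    using that by (intro filter_cong) auto
  ultimately show ?thesis by (auto simp: code_steps_def shuffles_with_def)
qed (simp add: code_steps_def)

lemma codes_0: "codes 0 m k = (if m = 0 \<and> k = 0 then {[]} else {})"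
  by (auto simp: codes_def)

lemma codes_Suc_0: "codes (Suc n) m 0 = {}"
  by (auto simp: codes_def length_Suc_conv)

text \<open>Since \<open>q\<close> and \<open>i\<close> are at most \<open>n\<close>, any bound
  \<open>b\<close> above \<open>n\<close> captures all cases. The program can thus use one loop
  bound for every cell.\<close>

lemma codes_Suc_Suc:
  assumes "n < b"
  shows "codes (Suc n) m (Suc k) = (\<Union>q<b. \<Union>i<b. code_steps n m k q i)"
proof (intro equalityI subsetI)
  fix L' assume "L' \<in> codes (Suc n) m (Suc k)"
  then obtain l L K where L: "L' = l # L" "length L = n" "length l + sum_list (map length L) = m"
    "distinct l" "set l \<subseteq> {k..<n}" "k \<le> K" "valid K L" "filter (\<lambda>x. x < K) l = [k..<K]"
    by (auto simp: codes_def length_Suc_conv)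
  have "K \<le> n" using valid_le_length[OF L(7)] L(2) by simp
  have "length [k..<K] \<le> length l" unfolding L(8)[symmetric] by (rule length_filter_le)
  moreover have "length l \<le> n"
    using card_mono[OF _ L(5)] L(4) by (simp add: distinct_card)
  ultimately have "L' \<in> code_steps n m k (K - k) (length l - (K - k))"
    using L \<open>K \<le> n\<close> by (auto simp: L(1) in_code_steps codes_def)
  moreover have "K - k < b" "length l - (K - k) < b"
    using \<open>K \<le> n\<close> \<open>length l \<le> n\<close> assms by auto
  ultimately show "L' \<in> (\<Union>q<b. \<Union>i<b. code_steps n m k q i)" by blast
next
  fix L' assume "L' \<in> (\<Union>q<b. \<Union>i<b. code_steps n m k q i)"
  then obtain q i where qi: "L' \<in> code_steps n m k q i" by blast
  then obtain l L where L': "L' = l # L" by (auto simp: code_steps_def split: if_splits)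
  with qi show "L' \<in> codes (Suc n) m (Suc k)"
    by (auto simp: in_code_steps codes_def intro!: exI[of _ "k + q"])
qed

lemma finite_codes: "finite (codes n m k)"
proof (induction n arbitrary: m k)
  case (Suc n)
  then have "finite (codes (Suc n) m (Suc k'))" for k'
    unfolding codes_Suc_Suc[OF lessI]
    by (auto simp: code_steps_def intro!: finite_imageI finite_cartesian_product finite_shuffles_with)
  then show ?case by (cases k) (auto simp: codes_Suc_0)
qed (simp add: codes_0)

lemma card_code_steps:
  "card (code_steps n m k q i) = (if q + i \<le> m \<and> k + q \<le> n
     then card (codes n (m - q - i) (k + q)) * weave (n - k - q) q i else 0)"
proof -
  have "card (shuffles_with [k..<k + q] {k + q..<n} i) = weave (n - k - q) q i"
    by (subst card_shuffles_with) auto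
  then show ?thesis
    by (auto simp: code_steps_def card_image inj_on_def card_cartesian_product)
qed

text \<open>The tail determines its number of sources \<open>k + q\<close>, and the length of the
  first list then gives \<open>i\<close>.\<close>

lemma code_steps_disjoint:
  assumes "L' \<in> code_steps n m k q i" "L' \<in> code_steps n m k q' i'"
  shows "q = q' \<and> i = i'"
proof -
  obtain l L where L': "L' = l # L" using assms(1) by (auto simp: code_steps_def split: if_splits)
  with assms have "valid (k + q) L" "valid (k + q') L" "length l = q + i" "length l = q' + i'"
    by (auto simp: in_code_steps codes_def)
  with valid_unique show ?thesis by force
qed

lemma card_codes_Suc_Suc:
  assumes "n < b"
  shows "card (codes (Suc n) m (Suc k)) = (\<Sum>q<b. \<Sum>i<b. card (code_steps n m k q i))"
proof -
  have fin: "finite (code_steps n m k q i)" for q i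
    by (auto simp: code_steps_def intro!: finite_imageI finite_cartesian_product
        finite_shuffles_with finite_codes)
  have "card (\<Union>q<b. \<Union>i<b. code_steps n m k q i) = (\<Sum>q<b. card (\<Union>i<b. code_steps n m k q i))"
  proof (rule card_UN_disjoint)
    show "\<forall>q\<in>{..<b}. \<forall>q'\<in>{..<b}. q \<noteq> q' \<longrightarrow>
      (\<Union>i<b. code_steps n m k q i) \<inter> (\<Union>i<b. code_steps n m k q' i) = {}"
      using code_steps_disjoint by blast
  qed (use fin in auto)
  also have "\<dots> = (\<Sum>q<b. \<Sum>i<b. card (code_steps n m k q i))"
  proof (intro sum.cong refl card_UN_disjoint)
    fix q
    show "\<forall>i\<in>{..<b}. \<forall>i'\<in>{..<b}. i \<noteq> i' \<longrightarrow>
      code_steps n m k q i \<inter> code_steps n m k q i' = {}"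
      using code_steps_disjoint by blast
  qed (use fin in auto)
  finally show ?thesis unfolding codes_Suc_Suc[OF assms] .
qed

section \<open>Vanishing and growth of the counts\<close>

lemma card_codes_gt: "n < k \<Longrightarrow> card (codes n m k) = 0"
  using valid_le_length by (force simp: codes_def card_eq_0_iff)

text \<open>Each of the \<open>q + i\<close> entries is the next prescribed one or one of at most
  \<open>a\<close> others, hence the base \<open>a + 1\<close>.\<close>

lemma weave_le: "weave a q i \<le> (a + 1) ^ (q + i)"
proof (induction a q i rule: weave.induct)
  case (2 a i)
  have "a * weave (a - 1) 0 i \<le> (a + 1) * (a + 1) ^ i"
    by (rule mult_mono) (use 2 power_mono[of "a - 1 + 1" "a + 1" i] in auto)
  then show ?case by simp
next
  case (3 a q i)
  have "weave (a - 1) (Suc q) i \<le> (a + 1) ^ (Suc q + i)"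
    using 3(2) power_mono[of "a - 1 + 1" "a + 1" "Suc q + i"] by linarith
  then have "a * weave (a - 1) (Suc q) i \<le> a * (a + 1) ^ (Suc q + i)" by simp
  with 3(1) show ?case by (simp add: algebra_simps)
qed simp

text \<open>Each vertex contributes a factor \<open>b * b\<close> for the choices of
  \<open>q\<close> and \<open>i\<close>, and each edge a factor \<open>b\<close> from
  \<open>weave_le\<close>.\<close>

lemma card_codes_le:
  assumes "n < b"
  shows "card (codes n m k) \<le> b ^ (2 * n + m)"
  using assms
proof (induction n arbitrary: m k)
  case 0
  then show ?case by (simp add: codes_0)
next
  case (Suc n)
  show ?case
  proof (cases k)
    case (Suc k')
    have "card (code_steps n m k' q i) \<le> b ^ (2 * n + m)" for q i
    proof (cases "q + i \<le> m \<and> k' + q \<le> n")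
      case True
      have "weave (n - k' - q) q i \<le> b ^ (q + i)"
        using weave_le[of "n - k' - q" q i] power_mono[of "n - k' - q + 1" b "q + i"] Suc.prems
        by linarith
      then have "card (code_steps n m k' q i) \<le> b ^ (2 * n + (m - q - i)) * b ^ (q + i)"
        using True Suc.IH[of "m - q - i" "k' + q"] Suc.prems
        unfolding card_code_steps by (simp only: if_True simp_thms) (intro mult_mono; simp)
      also have "\<dots> = b ^ (2 * n + m)" using True by (simp flip: power_add)
      finally show ?thesis .
    qed (auto simp: card_code_steps)
    then have "(\<Sum>q<b. \<Sum>i<b. card (code_steps n m k' q i)) \<le> (\<Sum>q<b. \<Sum>i<b. b ^ (2 * n + m))"
      by (intro sum_mono)
    then have "card (codes (Suc n) m k) \<le> (\<Sum>q<b. \<Sum>i<b. b ^ (2 * n + m))"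
      using card_codes_Suc_Suc[of n b m k'] Suc.prems \<open>k = Suc k'\<close> by simp
    then show ?thesis by (simp add: power_add power2_eq_square mult.assoc)
  qed (simp add: codes_Suc_0)
qed


section \<open>Reasoning about programs and their cost\<close>

definition small_mults :: "int \<Rightarrow> event list \<Rightarrow> bool" where
  "small_mults B tr \<longleftrightarrow> (\<forall>(x, y)\<in>set (mults tr). \<bar>x\<bar> \<le> B \<and> \<bar>y\<bar> \<le> B)"

lemma small_mults_simps [simp]:
  "small_mults B []"
  "small_mults B (Arith f x y # tr) \<longleftrightarrow> (f = Mul \<longrightarrow> \<bar>x\<bar> \<le> B \<and> \<bar>y\<bar> \<le> B) \<and> small_mults B tr"
  "small_mults B (Compare # tr) \<longleftrightarrow> small_mults B tr"
  "small_mults B (Store # tr) \<longleftrightarrow> small_mults B tr"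
  "small_mults B (tr @ tr') \<longleftrightarrow> small_mults B tr \<and> small_mults B tr'"
  by (cases f; auto simp: small_mults_def mults_def)+

text \<open>The budget \<open>t\<close> limits all elementary operations, so one bound yields both
  the running time and the number of multiplications; \<open>B\<close> limits the factors of
  multiplications only.\<close>

definition wp :: "int \<Rightarrow> com \<Rightarrow> nat \<Rightarrow> (mem \<Rightarrow> bool) \<Rightarrow> mem \<Rightarrow> bool" where
  "wp B c t Q s \<longleftrightarrow> (\<exists>tr s'. exec c s tr s' \<and> Q s' \<and> length tr \<le> t \<and> small_mults B tr)"

lemma wp_mono: "wp B c t Q s \<Longrightarrow> t \<le> t' \<Longrightarrow> (\<And>s'. Q s' \<Longrightarrow> Q' s') \<Longrightarrow> wp B c t' Q' s"
  unfolding wp_def by (meson order_trans)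

text \<open>The strict inequality leaves one operation for the final \<open>Store\<close>.\<close>

lemma wp_Assign:
  assumes "length (concat (map (events s) is) @ events s a) < t"
    and "small_mults B (concat (map (events s) is) @ events s a)"
    and "Q (s(x := (s x)(map (eval s) is := eval s a)))"
  shows "wp B (Assign x is a) t Q s"
  unfolding wp_def using exec.Assign[of x "is" a s] assms by (fastforce simp del: fun_upd_apply)

lemma wp_Seq:
  assumes "wp B c t (wp B c' u Q) s" "t + u \<le> t'"
  shows "wp B (Seq c c') t' Q s"
proof -
  obtain tr1 s1 tr2 s2 where "exec c s tr1 s1" "length tr1 \<le> t" "small_mults B tr1"
    "exec c' s1 tr2 s2" "length tr2 \<le> u" "small_mults B tr2" "Q s2"
    using assms(1) unfolding wp_def by blast
  then show ?thesis
    unfolding wp_def using assms(2) by (intro exI[of _ "tr1 @ tr2"] exI[of _ s2]) (auto intro: exec.Seq)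
qed

text \<open>Here strictness accounts for the \<open>Compare\<close>.\<close>

lemma wp_If:
  assumes "wp B (if eval s a < eval s b then c1 else c2) t' Q s"
    and "small_mults B (events s a @ events s b)"
    and "length (events s a @ events s b) + t' < t"
  shows "wp B (If_Less a b c1 c2) t Q s"
proof -
  obtain tr s' where tr: "exec (if eval s a < eval s b then c1 else c2) s tr s'"
    "length tr \<le> t'" "small_mults B tr" "Q s'"
    using assms(1) unfolding wp_def by blast
  then have "exec (If_Less a b c1 c2) s (events s a @ events s b @ Compare # tr) s'"
    by (auto intro: exec.intros split: if_splits)
  with tr assms(2,3) show ?thesis
    unfolding wp_def by (intro exI[of _ "events s a @ events s b @ Compare # tr"]) auto
qed

abbreviation Var :: "string \<Rightarrow> expr" where
  "Var x \<equiv> Cell x []"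

definition For :: "string \<Rightarrow> string \<Rightarrow> com \<Rightarrow> com" where
  "For x h c = Seq (Assign x [] (Num 0))
     (While_Less (Var x) (Var h) (Seq c (Assign x [] (Op Add (Var x) (Num 1)))))"

text \<open>An iteration costs \<open>t + 3\<close>: a comparison, the increment and its store. The
  initial store and the last comparison are absorbed by \<open>H * (t + 5)\<close> because
  \<open>0 < H\<close>. The hypothesis \<open>upd\<close> keeps the counter out of the invariant,
  whose argument \<open>j\<close> tracks it instead.\<close>

lemma wp_For:
  assumes body: "\<And>j s. j < H \<Longrightarrow> I j s \<Longrightarrow> s x [] = int j \<Longrightarrow>
      wp B c t (\<lambda>s'. I (Suc j) s' \<and> s' x [] = int j) s"
    and upd: "\<And>j s f. I j s \<Longrightarrow> I j (s(x := f))"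
    and bound: "\<And>j s. I j s \<Longrightarrow> s h [] = int H"
    and "0 < H" "H * (t + 5) \<le> t'" "I 0 s" "\<And>s'. I H s' \<Longrightarrow> Q s'"
  shows "wp B (For x h c) t' Q s"
proof -
  let ?b = "Seq c (Assign x [] (Op Add (Var x) (Num 1)))"
  let ?w = "While_Less (Var x) (Var h) ?b"
  have while: "wp B ?w ((H - j) * (t + 3) + 1) (I H) s"
    if "j \<le> H" "I j s" "s x [] = int j" for j s
    using that
  proof (induction "H - j" arbitrary: j s)
    case 0
    then have "exec ?w s [Compare] s"
      using exec.While_False[of s "Var x" "Var h" ?b] bound by auto
    with 0 show ?case unfolding wp_def by (intro exI[of _ "[Compare]"] exI[of _ s]) auto
  next
    case (Suc d)
    then have "j < H" by simp
    from body[OF this Suc.prems(2,3)] obtain tr1 s1 where 1: "exec c s tr1 s1" "I (Suc j) s1"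
      "s1 x [] = int j" "length tr1 \<le> t" "small_mults B tr1"
      unfolding wp_def by blast
    let ?s = "s1(x := (s1 x)([] := int (Suc j)))"
    have "exec (Assign x [] (Op Add (Var x) (Num 1))) s1 [Arith Add (int j) 1, Store] ?s"
      using exec.Assign[of x "[]" "Op Add (Var x) (Num 1)" s1] 1(3) by (simp add: add.commute)
    with 1(1) have 2: "exec ?b s (tr1 @ [Arith Add (int j) 1, Store]) ?s" by (rule exec.Seq)
    have "d = H - Suc j" "Suc j \<le> H" using Suc.hyps(2) \<open>j < H\<close> by auto
    moreover have "?s x [] = int (Suc j)" by simp
    ultimately have "wp B ?w ((H - Suc j) * (t + 3) + 1) (I H) ?s"
      using Suc.hyps(1) upd[OF 1(2)] by blast
    then obtain tr2 s2 where 3: "exec ?w ?s tr2 s2" "I H s2"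
      "length tr2 \<le> (H - Suc j) * (t + 3) + 1" "small_mults B tr2"
      unfolding wp_def by blast
    have "eval s (Var x) < eval s (Var h)"
      using bound[OF Suc.prems(2)] Suc.prems(3) \<open>j < H\<close> by simp
    from exec.While_True[OF this 2 3(1)]
    have "exec ?w s (Compare # (tr1 @ [Arith Add (int j) 1, Store]) @ tr2) s2" by simp
    moreover have "H - j = Suc (H - Suc j)" using \<open>j < H\<close> by simp
    ultimately show ?case
      using 1(4,5) 3 unfolding wp_def
      by (intro exI[of _ "Compare # (tr1 @ [Arith Add (int j) 1, Store]) @ tr2"] exI[of _ s2]) auto
  qed
  have "wp B (Assign x [] (Num 0)) 1 (wp B ?w (H * (t + 3) + 1) (I H)) s"
    by (rule wp_Assign) (use while[of 0] upd[OF \<open>I 0 s\<close>] in auto)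
  then have "wp B (For x h c) (1 + (H * (t + 3) + 1)) (I H) s"
    unfolding For_def by (rule wp_Seq) simp
  then show ?thesis
  proof (rule wp_mono)
    have "1 + (H * (t + 3) + 1) \<le> H * (t + 5)" using \<open>0 < H\<close> by (simp add: algebra_simps)
    with assms(5) show "1 + (H * (t + 3) + 1) \<le> t'" by linarith
  qed (rule assms(7))
qed


section \<open>The program\<close>

text \<open>Extending the counts by 0 to negative indices matches the memory, where cells never
  written hold 0. Boundary terms then fit the general recurrences.\<close>

definition weave_at :: "int \<Rightarrow> int \<Rightarrow> int \<Rightarrow> int" where
  "weave_at a q i = (if a < 0 \<or> q < 0 \<or> i < 0 then 0 else int (weave (nat a) (nat q) (nat i)))"

definition codes_at :: "int \<Rightarrow> int \<Rightarrow> int \<Rightarrow> int" where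
  "codes_at n m k = (if n < 0 \<or> m < 0 \<or> k < 0 then 0 else int (card (codes (nat n) (nat m) (nat k))))"

text \<open>For \<open>q = 0\<close> the first term vanishes, and for \<open>a = 0\<close> the
  factor \<open>int a\<close> removes the second, so all cases with \<open>0 < i\<close> share one
  equation.\<close>

lemma weave_at_rec:
  "weave_at (int a) (int q) (int i) = (if i = 0 then 1
     else weave_at (int a) (int q - 1) (int i) + int a * weave_at (int a - 1) (int q) (int i - 1))"
proof -
  have "nat (1 + int x) = Suc x" for x by simp
  then show ?thesis by (cases i; cases q; cases a) (auto simp: weave_at_def algebra_simps)
qed

text \<open>Outside the guard of \<open>code_steps\<close> a factor has a negative index and
  vanishes: the first if \<open>q + i > m\<close>, the second if \<open>k + q > n\<close>.\<close>

lemma codes_at_rec: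
  assumes "n < b"
  shows "codes_at (int n + 1) (int m) (int k + 1) = (\<Sum>q<b. \<Sum>i<b.
    codes_at (int n) (int m - int q - int i) (int k + int q) *
    weave_at (int n - int k - int q) (int q) (int i))"
proof -
  have "int (card (code_steps n m k q i)) =
    codes_at (int n) (int m - int q - int i) (int k + int q) *
    weave_at (int n - int k - int q) (int q) (int i)" for q i
  proof (cases "q + i \<le> m \<and> k + q \<le> n")
    case True
    then have "nat (int m - int q - int i) = m - q - i" "nat (int k + int q) = k + q"
      "nat (int n - int k - int q) = n - k - q" by auto
    with True show ?thesis by (simp add: card_code_steps codes_at_def weave_at_def)
  next
    case False
    then show ?thesis by (auto simp: card_code_steps codes_at_def weave_at_def)
  qed
  moreover have "nat (int n + 1) = Suc n" "nat (int k + 1) = Suc k" by auto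
  ultimately show ?thesis
    using card_codes_Suc_Suc[OF assms, of m k] by (simp add: codes_at_def)
qed

text \<open>This confines the support of the counts, so that cells which the program does not reach
  are known to hold the correct value 0.\<close>

lemma codes_at_nonzero:
  assumes "codes_at n m k \<noteq> 0"
  shows "0 \<le> n \<and> 0 \<le> m \<and> 0 \<le> k \<and> k \<le> n \<and> (n = 0 \<longrightarrow> m = 0) \<and> (0 < n \<longrightarrow> 0 < k)"
proof -
  have *: "0 \<le> n" "0 \<le> m" "0 \<le> k" using assms by (auto simp: codes_at_def split: if_splits)
  moreover have "k \<le> n" using assms * card_codes_gt[of "nat n" "nat k" "nat m"]
    by (force simp: codes_at_def)
  moreover have "n = 0 \<longrightarrow> m = 0" using assms * by (auto simp: codes_at_def codes_0 split: if_splits)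
  moreover have "0 < n \<longrightarrow> 0 < k"
  proof (intro impI, rule ccontr)
    assume "0 < n" "\<not> 0 < k"
    then have "k = 0" "nat n = Suc (nat (n - 1))" using * by auto
    then have "codes (nat n) (nat m) (nat k) = {}" by (metis codes_Suc_0 nat_0)
    with assms show False by (simp add: codes_at_def split: if_splits)
  qed
  ultimately show ?thesis by blast
qed

section \<open>Arrays filled up to a loop counter\<close>

definition table ::
    "(int \<Rightarrow> int \<Rightarrow> int \<Rightarrow> bool) \<Rightarrow> (int \<Rightarrow> int \<Rightarrow> int \<Rightarrow> int) \<Rightarrow> int list \<Rightarrow> int" where
  "table P f l = (case l of [x, y, z] \<Rightarrow> if P x y z then f x y z else 0 | _ \<Rightarrow> 0)"

lemma table_apply [simp]: "table P f [x, y, z] = (if P x y z then f x y z else 0)"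
  by (simp add: table_def)

lemma table_update:
  "(table P f)([x, y, z] := f x y z) =
     table (\<lambda>x' y' z'. P x' y' z' \<or> x' = x \<and> y' = y \<and> z' = z) f"
  by (rule ext) (auto simp: table_def split: list.splits)

text \<open>Unwritten cells already hold 0, so the regions may differ wherever \<open>f\<close>
  vanishes.\<close>

lemma table_cong:
  "(\<And>x y z. f x y z \<noteq> 0 \<Longrightarrow> P x y z \<longleftrightarrow> Q x y z) \<Longrightarrow> table P f = table Q f"
  by (rule ext) (auto simp: table_def split: list.splits)

text \<open>
  The contents of the arrays when the loops have reached the counters \<open>(a, q, i)\<close> and \<open>(n, m, k)\<close>;
  the latter are about to compute the cell \<open>(n + 1, m, k + 1)\<close>.
\<close>

definition weave_table :: "nat \<Rightarrow> nat \<Rightarrow> nat \<Rightarrow> nat \<Rightarrow> int list \<Rightarrow> int" where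
  "weave_table L a q i = table (\<lambda>x y z. x < int L \<and> y < int L \<and> z < int L \<and>
     (x < int a \<or> x = int a \<and> (y < int q \<or> y = int q \<and> z < int i))) weave_at"

definition codes_table :: "nat \<Rightarrow> nat \<Rightarrow> nat \<Rightarrow> nat \<Rightarrow> int list \<Rightarrow> int" where
  "codes_table K n m k = table (\<lambda>x y z. y < int K \<and>
     (x \<le> int n \<or> x = int n + 1 \<and> (y < int m \<or> y = int m \<and> z \<le> int k))) codes_at"

definition weave_body :: com where
  "weave_body = If_Less (Var ''i'') (Num 1)
     (Assign ''W'' [Var ''a'', Var ''q'', Var ''i''] (Num 1))
     (Assign ''W'' [Var ''a'', Var ''q'', Var ''i'']
       (Op Add (Cell ''W'' [Var ''a'', Op Sub (Var ''q'') (Num 1), Var ''i''])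
         (Op Mul (Var ''a'')
           (Cell ''W'' [Op Sub (Var ''a'') (Num 1), Var ''q'', Op Sub (Var ''i'') (Num 1)]))))"

definition weave_prog :: com where
  "weave_prog = For ''a'' ''L'' (For ''q'' ''L'' (For ''i'' ''L'' weave_body))"

definition sum_body :: com where
  "sum_body = Assign ''acc'' [] (Op Add (Var ''acc'') (Op Mul
     (Cell ''D'' [Var ''n'', Op Sub (Op Sub (Var ''m'') (Var ''q'')) (Var ''i''),
        Op Add (Var ''k'') (Var ''q'')])
     (Cell ''W'' [Op Sub (Op Sub (Var ''n'') (Var ''k'')) (Var ''q''), Var ''q'', Var ''i''])))"

definition cell_prog :: com where
  "cell_prog = Seq (Assign ''acc'' [] (Num 0))
     (Seq (For ''q'' ''L'' (For ''i'' ''L'' sum_body))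
       (Assign ''D'' [Op Add (Var ''n'') (Num 1), Var ''m'', Op Add (Var ''k'') (Num 1)]
         (Var ''acc'')))"

text \<open>Together with the loops over \<open>q\<close> and \<open>i\<close> in
  \<open>cell_prog\<close>, four loops run to \<open>L\<close> and one to \<open>K\<close>, which
  gives the order \<open>L ^ 4 * K\<close>.\<close>

definition codes_prog :: com where
  "codes_prog = For ''n'' ''L'' (For ''m'' ''K'' (For ''k'' ''L'' cell_prog))"

text \<open>
  For \<open>N = 1\<close> the admissible bit size \<open>max M N * ln N\<close> is \<open>0\<close>, so this case is treated without
  multiplications.
\<close>

definition doag_prog :: com where
  "doag_prog = Seq (Assign ''D'' [Num 0, Num 0, Num 0] (Num 1))
     (If_Less (Var ''N'') (Num 2)
       (Assign ''D'' [Num 1, Num 0, Num 1] (Num 1))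
       (Seq (Assign ''L'' [] (Op Add (Var ''N'') (Num 1)))
         (Seq (Assign ''K'' [] (Op Add (Var ''M'') (Num 1)))
           (Seq weave_prog codes_prog))))"

section \<open>Operand bounds and the evolution of the tables\<close>

definition op_bound :: "nat \<Rightarrow> nat \<Rightarrow> int" where
  "op_bound L K = int L ^ (2 * L + K)"

lemma weave_at_bound:
  assumes "x < int L" "y < int L" "z < int L" "0 < L"
  shows "\<bar>weave_at x y z\<bar> \<le> op_bound L K"
proof (cases "x < 0 \<or> y < 0 \<or> z < 0")
  case False
  have "weave (nat x) (nat y) (nat z) \<le> (nat x + 1) ^ (nat y + nat z)" by (rule weave_le)
  also have "\<dots> \<le> L ^ (nat y + nat z)" using assms False by (intro power_mono) auto
  also have "\<dots> \<le> L ^ (2 * L + K)" using assms False by (intro power_increasing) auto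
  finally have "int (weave (nat x) (nat y) (nat z)) \<le> int (L ^ (2 * L + K))" by linarith
  then show ?thesis using False by (simp add: weave_at_def op_bound_def)
qed (auto simp: weave_at_def op_bound_def)

lemma codes_at_bound:
  assumes "x < int L" "y < int K" "0 < L"
  shows "\<bar>codes_at x y z\<bar> \<le> op_bound L K"
proof (cases "x < 0 \<or> y < 0 \<or> z < 0")
  case False
  have "card (codes (nat x) (nat y) (nat z)) \<le> L ^ (2 * nat x + nat y)"
    using assms False by (intro card_codes_le) auto
  also have "\<dots> \<le> L ^ (2 * L + K)" using assms False by (intro power_increasing) auto
  finally have "int (card (codes (nat x) (nat y) (nat z))) \<le> int (L ^ (2 * L + K))" by linarith
  then show ?thesis using False by (simp add: codes_at_def op_bound_def)
qed (auto simp: codes_at_def op_bound_def)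

lemma le_op_bound: "0 < L \<Longrightarrow> int L \<le> op_bound L K"
  unfolding op_bound_def by (rule self_le_power) auto

text \<open>The region of this table meets only cells with a negative index, so it describes the
  initial zero memory.\<close>

lemma weave_table_0: "weave_table L 0 0 0 = (\<lambda>_. 0)"
proof -
  have "weave_table L 0 0 0 = table (\<lambda>_ _ _. False) weave_at"
    unfolding weave_table_def by (rule table_cong) (auto simp: weave_at_def split: if_splits)
  also have "\<dots> = (\<lambda>_. 0)" by (rule ext) (simp add: table_def split: list.split)
  finally show ?thesis .
qed

lemma weave_table_Suc:
  assumes "a < L" "q < L" "i < L"
  shows "(weave_table L a q i)([int a, int q, int i] := weave_at (int a) (int q) (int i)) =
    weave_table L a q (Suc i)"
  unfolding weave_table_def table_update using assms by (intro table_cong) auto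

lemma weave_table_row: "weave_table L a q L = weave_table L a (Suc q) 0"
  unfolding weave_table_def by (rule table_cong) (auto simp: weave_at_def split: if_splits)

lemma weave_table_layer: "weave_table L a L 0 = weave_table L (Suc a) 0 0"
  unfolding weave_table_def by (rule table_cong) (auto simp: weave_at_def split: if_splits)

text \<open>The only nonzero entry without vertices is that of the empty code. A nonempty graph has
  a source, so the cells with 0 sources in the next layer may count as filled.\<close>

lemma codes_table_0: "0 < K \<Longrightarrow> (\<lambda>_. 0)([0, 0, 0] := 1) = codes_table K 0 0 0"
proof -
  assume K: "0 < K"
  have "(\<lambda>_. 0) = table (\<lambda>_ _ _. False) codes_at"
    by (rule ext) (simp add: table_def split: list.split)
  moreover have "codes_at 0 0 0 = 1" by (simp add: codes_at_def codes_0)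
  ultimately have "(\<lambda>_. 0)([0, 0, 0] := 1) =
      (table (\<lambda>_ _ _. False) codes_at)([0, 0, 0] := codes_at 0 0 0)" by simp
  also have "\<dots> = codes_table K 0 0 0"
    unfolding table_update codes_table_def
    by (rule table_cong, drule codes_at_nonzero) (use K in auto)
  finally show ?thesis .
qed

lemma codes_table_Suc:
  assumes "m < K"
  shows "(codes_table K n m k)([int n + 1, int m, int k + 1] :=
      codes_at (int n + 1) (int m) (int k + 1)) = codes_table K n m (Suc k)"
  unfolding codes_table_def table_update using assms by (intro table_cong) auto

text \<open>In layer \<open>n + 1\<close> there are at most \<open>n + 1 \<le> L\<close> sources, so
  a row filled through \<open>L\<close> is complete.\<close>

lemma codes_table_row:
  assumes "n < L"
  shows "codes_table K n m L = codes_table K n (Suc m) 0"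
  unfolding codes_table_def by (rule table_cong, drule codes_at_nonzero) (use assms in auto)

lemma codes_table_layer: "codes_table K n K 0 = codes_table K (Suc n) 0 0"
  unfolding codes_table_def by (rule table_cong, drule codes_at_nonzero) auto


section \<open>Correctness and cost of the program\<close>

lemma wp_weave_body:
  assumes "a < L" "q < L" "i < L" "s ''W'' = weave_table L a q i"
    and "s ''a'' [] = int a" "s ''q'' [] = int q" "s ''i'' [] = int i"
  shows "wp (op_bound L K) weave_body 8 (\<lambda>s'. s' = s(''W'' := weave_table L a q (Suc i))) s"
proof (cases "i = 0")
  case True
  then have "weave_at (int a) (int q) 0 = 1" using weave_at_rec[of a q 0] by simp
  with assms True show ?thesis unfolding weave_body_def
    by (intro wp_If[where t' = 2] wp_Assign) (auto intro!: wp_Assign simp flip: weave_table_Suc)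
next
  case False
  \<comment> \<open>Both cells precede the current one in loop order; an index \<open>-1\<close>
    falls in the region too, with value 0.\<close>
  have "weave_table L a q i [int a, int q - 1, int i] = weave_at (int a) (int q - 1) (int i)"
    "weave_table L a q i [int a - 1, int q, int i - 1] = weave_at (int a - 1) (int q) (int i - 1)"
    using assms by (auto simp: weave_table_def)
  moreover have "\<bar>weave_at (int a - 1) (int q) (int i - 1)\<bar> \<le> op_bound L K" "\<bar>int a\<bar> \<le> op_bound L K"
    using assms(1-3) weave_at_bound[of "int a - 1" L "int q" "int i - 1" K] le_op_bound[of L K]
    by auto
  ultimately show ?thesis
    using assms False weave_at_rec[of a q i] unfolding weave_body_def
    by (intro wp_If[where t' = 7] wp_Assign) (auto intro!: wp_Assign simp flip: weave_table_Suc)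
qed

text \<open>By \<open>wp_For\<close> and \<open>0 < L\<close>, each level of nesting raises the
  constant by 5: from 8 to 13, 18 and 23.\<close>

lemma wp_weave_prog:
  assumes "0 < L"
    and "s ''L'' [] = int L \<and> s ''K'' [] = int K \<and> s ''D'' = d \<and> s ''W'' = (\<lambda>_. 0)"
  shows "wp (op_bound L K) weave_prog (23 * L ^ 3) (\<lambda>s'. s' ''L'' [] = int L \<and>
    s' ''K'' [] = int K \<and> s' ''D'' = d \<and> s' ''W'' = weave_table L L 0 0) s"
proof -
  let ?base = "\<lambda>s :: mem. s ''L'' [] = int L \<and> s ''K'' [] = int K \<and> s ''D'' = d"
  have row: "wp (op_bound L K) (For ''i'' ''L'' weave_body) (13 * L) (\<lambda>s'. (?base s' \<and>
      s' ''a'' [] = int a \<and> s' ''W'' = weave_table L a (Suc q) 0) \<and> s' ''q'' [] = int q) s"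
    if "a < L" "q < L" "?base s" "s ''a'' [] = int a" "s ''W'' = weave_table L a q 0"
      "s ''q'' [] = int q" for a q s
  proof (rule wp_For[where H = L and t = 8 and I = "\<lambda>j s. ?base s \<and> s ''a'' [] = int a \<and>
        s ''q'' [] = int q \<and> s ''W'' = weave_table L a q j"], goal_cases)
    case (1 j s)
    show ?case
      by (rule wp_mono[OF wp_weave_body[of a L q j]]) (use 1 that(1,2) in simp_all)
  qed (use that assms(1) in \<open>simp_all add: weave_table_row\<close>)
  have layer: "wp (op_bound L K) (For ''q'' ''L'' (For ''i'' ''L'' weave_body)) (18 * L\<^sup>2)
      (\<lambda>s'. (?base s' \<and> s' ''W'' = weave_table L (Suc a) 0 0) \<and> s' ''a'' [] = int a) s"
    if "a < L" "?base s" "s ''W'' = weave_table L a 0 0" "s ''a'' [] = int a" for a s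
  proof (rule wp_For[where H = L and t = "13 * L" and I = "\<lambda>j s. ?base s \<and> s ''a'' [] = int a \<and>
        s ''W'' = weave_table L a j 0"], goal_cases)
    case (1 j s)
    show ?case
      by (rule wp_mono[OF row[of a j]]) (use 1 that(1) in simp_all)
  qed (use that assms(1) in \<open>simp_all add: weave_table_layer power2_eq_square\<close>)
  show ?thesis
    unfolding weave_prog_def
  proof (rule wp_For[where H = L and t = "18 * L\<^sup>2" and
        I = "\<lambda>j s. ?base s \<and> s ''W'' = weave_table L j 0 0"], goal_cases)
    case (1 j s)
    show ?case
      by (rule wp_mono[OF layer[of j]]) (use 1 in simp_all)
  qed (use assms in \<open>simp_all add: weave_table_0 power2_eq_square power3_eq_cube\<close>)
qed

definition summand :: "nat \<Rightarrow> nat \<Rightarrow> nat \<Rightarrow> nat \<Rightarrow> nat \<Rightarrow> int" where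
  "summand n m k q i = codes_at (int n) (int m - int q - int i) (int k + int q) *
     weave_at (int n - int k - int q) (int q) (int i)"

lemma wp_sum_body:
  assumes "n < L" "m < K" "q < L" "i < L"
    and "s ''W'' = weave_table L L 0 0" "s ''D'' = codes_table K n m k"
    and "s ''n'' [] = int n" "s ''m'' [] = int m" "s ''k'' [] = int k"
    and "s ''q'' [] = int q" "s ''i'' [] = int i"
  shows "wp (op_bound L K) sum_body 8
    (\<lambda>s'. s' = s(''acc'' := (s ''acc'')([] := s ''acc'' [] + summand n m k q i))) s"
proof -
  \<comment> \<open>Layer \<open>n\<close> of the code table and the whole table of
    \<open>weave\<close> are complete at this point; negative indices read 0.\<close>
  have "codes_table K n m k [int n, int m - int q - int i, int k + int q] =
      codes_at (int n) (int m - int q - int i) (int k + int q)"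
    "weave_table L L 0 0 [int n - int k - int q, int q, int i] =
      weave_at (int n - int k - int q) (int q) (int i)"
    using assms(1-4) by (auto simp: codes_table_def weave_table_def)
  moreover have
    "\<bar>codes_at (int n) (int m - int q - int i) (int k + int q)\<bar> \<le> op_bound L K"
    "\<bar>weave_at (int n - int k - int q) (int q) (int i)\<bar> \<le> op_bound L K"
    using assms(1-4) by (auto intro: codes_at_bound weave_at_bound)
  ultimately show ?thesis
    using assms(5-) unfolding sum_body_def by (intro wp_Assign) (auto simp: summand_def)
qed

text \<open>The two summation loops cost \<open>18 * L ^ 2\<close>; clearing the accumulator and
  storing the result add at most 5.\<close>

lemma wp_cell_prog:
  assumes "n < L" "m < K"
    and "s ''L'' [] = int L" "s ''W'' = weave_table L L 0 0" "s ''D'' = codes_table K n m k"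
    and "s ''n'' [] = int n" "s ''m'' [] = int m" "s ''k'' [] = int k" "s ''K'' [] = int K"
  shows "wp (op_bound L K) cell_prog (23 * L\<^sup>2) (\<lambda>s'. s' ''L'' [] = int L \<and>
    s' ''K'' [] = int K \<and> s' ''W'' = weave_table L L 0 0 \<and> s' ''D'' = codes_table K n m (Suc k) \<and>
    s' ''n'' [] = int n \<and> s' ''m'' [] = int m \<and> s' ''k'' [] = int k) s"
proof -
  let ?base = "\<lambda>s :: mem. s ''L'' [] = int L \<and> s ''K'' [] = int K \<and>
    s ''W'' = weave_table L L 0 0 \<and> s ''D'' = codes_table K n m k \<and>
    s ''n'' [] = int n \<and> s ''m'' [] = int m \<and> s ''k'' [] = int k"
  let ?store = "Assign ''D'' [Op Add (Var ''n'') (Num 1), Var ''m'', Op Add (Var ''k'') (Num 1)]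
    (Var ''acc'')"
  let ?Q = "\<lambda>s' :: mem. s' ''L'' [] = int L \<and> s' ''K'' [] = int K \<and> s' ''W'' = weave_table L L 0 0 \<and>
    s' ''D'' = codes_table K n m (Suc k) \<and>
    s' ''n'' [] = int n \<and> s' ''m'' [] = int m \<and> s' ''k'' [] = int k"
  have L: "0 < L" "1 \<le> L\<^sup>2" using assms(1) by auto
  have row: "wp (op_bound L K) (For ''i'' ''L'' sum_body) (13 * L) (\<lambda>s'. (?base s' \<and>
      s' ''acc'' [] = (\<Sum>q'<Suc q. \<Sum>i<L. summand n m k q' i)) \<and> s' ''q'' [] = int q) s"
    if "q < L" "?base s" "s ''acc'' [] = (\<Sum>q'<q. \<Sum>i<L. summand n m k q' i)"
      "s ''q'' [] = int q" for q s
  proof (rule wp_For[where H = L and t = 8 and I = "\<lambda>j s. ?base s \<and> s ''q'' [] = int q \<and>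
        s ''acc'' [] = (\<Sum>q'<q. \<Sum>i<L. summand n m k q' i) + (\<Sum>i<j. summand n m k q i)"], goal_cases)
    case (1 j s)
    show ?case
      by (rule wp_mono[OF wp_sum_body[of n L m K q j _ k]]) (use 1 that(1) assms(1,2) in simp_all)
  qed (use that L in simp_all)
  have sum: "wp (op_bound L K) (For ''q'' ''L'' (For ''i'' ''L'' sum_body)) (18 * L\<^sup>2) (\<lambda>s'. ?base s' \<and>
      s' ''acc'' [] = (\<Sum>q<L. \<Sum>i<L. summand n m k q i)) s"
    if "?base s" "s ''acc'' [] = 0" for s
  proof (rule wp_For[where H = L and t = "13 * L" and I = "\<lambda>j s. ?base s \<and>
        s ''acc'' [] = (\<Sum>q'<j. \<Sum>i<L. summand n m k q' i)"], goal_cases)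
    case (1 j s)
    show ?case
      by (rule wp_mono[OF row[of j]]) (use 1 in simp_all)
  qed (use that L in \<open>simp_all add: power2_eq_square\<close>)
  \<comment> \<open>\<open>codes_at_rec\<close> applies with \<open>b = L\<close>, because the
    counter \<open>n\<close> is below \<open>L\<close>.\<close>
  have "(\<Sum>q<L. \<Sum>i<L. summand n m k q i) = codes_at (int n + 1) (int m) (int k + 1)"
    using codes_at_rec[OF assms(1)] by (simp add: summand_def)
  then have store: "wp (op_bound L K) ?store 3 ?Q s"
    if "?base s \<and> s ''acc'' [] = (\<Sum>q<L. \<Sum>i<L. summand n m k q i)" for s
    using that by (intro wp_Assign) (simp_all add: codes_table_Suc[OF assms(2)])
  have "wp (op_bound L K) (Seq (For ''q'' ''L'' (For ''i'' ''L'' sum_body)) ?store) (18 * L\<^sup>2 + 3) ?Q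
      (s(''acc'' := (s ''acc'')(map (eval s) [] := eval s (Num 0))))"
    by (rule wp_Seq[OF wp_mono[OF sum order_refl store] order_refl]) (use assms in simp_all)
  then have "wp (op_bound L K) (Assign ''acc'' [] (Num 0)) 2 (wp (op_bound L K)
      (Seq (For ''q'' ''L'' (For ''i'' ''L'' sum_body)) ?store) (18 * L\<^sup>2 + 3) ?Q) s"
    by (rule wp_Assign[rotated 2]) simp_all
  then show ?thesis
    unfolding cell_prog_def by (rule wp_Seq) (use L in simp)
qed

text \<open>Three more levels raise the constant from 23 to 38, the loop over \<open>m\<close>
  contributing the factor \<open>K\<close>.\<close>

lemma wp_codes_prog:
  assumes "0 < L" "0 < K"
    and "s ''L'' [] = int L \<and> s ''K'' [] = int K \<and> s ''W'' = weave_table L L 0 0 \<and>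
      s ''D'' = codes_table K 0 0 0"
  shows "wp (op_bound L K) codes_prog (38 * L ^ 4 * K) (\<lambda>s'. s' ''D'' = codes_table K L 0 0) s"
proof -
  let ?base = "\<lambda>s :: mem. s ''L'' [] = int L \<and> s ''K'' [] = int K \<and> s ''W'' = weave_table L L 0 0"
  have row: "wp (op_bound L K) (For ''k'' ''L'' cell_prog) (28 * L ^ 3) (\<lambda>s'. (?base s' \<and>
      s' ''n'' [] = int n \<and> s' ''D'' = codes_table K n (Suc m) 0) \<and> s' ''m'' [] = int m) s"
    if "n < L" "m < K" "?base s" "s ''n'' [] = int n" "s ''D'' = codes_table K n m 0"
      "s ''m'' [] = int m" for n m s
  proof (rule wp_For[where H = L and t = "23 * L\<^sup>2" and I = "\<lambda>j s. ?base s \<and> s ''n'' [] = int n \<and>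
        s ''m'' [] = int m \<and> s ''D'' = codes_table K n m j"], goal_cases)
    case (1 j s)
    show ?case
      by (rule wp_mono[OF wp_cell_prog[of n L m K _ j]]) (use 1 that(1,2) in simp_all)
  qed (use that assms(1) in \<open>simp_all add: codes_table_row power2_eq_square power3_eq_cube\<close>)
  have layer: "wp (op_bound L K) (For ''m'' ''K'' (For ''k'' ''L'' cell_prog)) (33 * L ^ 3 * K)
      (\<lambda>s'. (?base s' \<and> s' ''D'' = codes_table K (Suc n) 0 0) \<and> s' ''n'' [] = int n) s"
    if "n < L" "?base s" "s ''D'' = codes_table K n 0 0" "s ''n'' [] = int n" for n s
  proof (rule wp_For[where H = K and t = "28 * L ^ 3" and I = "\<lambda>j s. ?base s \<and> s ''n'' [] = int n \<and>
        s ''D'' = codes_table K n j 0"], goal_cases)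
    case (1 j s)
    show ?case
      by (rule wp_mono[OF row[of n j]]) (use 1 that(1) in simp_all)
  next
    case 5
    have "1 \<le> L ^ 3" using assms(1) by simp
    then have "K * (28 * L ^ 3 + 5) \<le> K * (33 * L ^ 3)" by (intro mult_le_mono) auto
    then show ?case by (simp add: mult.commute)
  qed (use that assms in \<open>simp_all add: codes_table_layer\<close>)
  have "1 \<le> L ^ 3 * K" using assms(1,2) by (simp add: Suc_le_eq)
  then have "L * (33 * L ^ 3 * K + 5) \<le> L * (38 * L ^ 3 * K)" by (intro mult_le_mono) auto
  also have "\<dots> = 38 * L ^ 4 * K" by (simp add: power4_eq_xxxx power3_eq_cube)
  finally have time: "L * (33 * L ^ 3 * K + 5) \<le> 38 * L ^ 4 * K" .
  show ?thesis
    unfolding codes_prog_def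
  proof (rule wp_For[where H = L and t = "33 * L ^ 3 * K" and
        I = "\<lambda>j s. ?base s \<and> s ''D'' = codes_table K j 0 0"], goal_cases)
    case (1 j s)
    show ?case
      by (rule wp_mono[OF layer[of j]]) (use 1 in simp_all)
  qed (use assms time in simp_all)
qed


lemma wp_doag_prog:
  assumes N: "2 \<le> N" and L: "int L = int N + 1" and K: "int K = int M + 1"
  shows "wp (op_bound L K) doag_prog (70 * L ^ 4 * K) (\<lambda>s. s ''D'' = codes_table K L 0 0)
    (input N M)"
proof -
  let ?Q = "\<lambda>s :: mem. s ''D'' = codes_table K L 0 0"
  let ?B = "op_bound L K"
  let ?t = "23 * L ^ 3 + 38 * L ^ 4 * K"
  have pos: "0 < L" "0 < K" using L K by linarith+
  have main: "wp ?B (Seq weave_prog codes_prog) ?t ?Q s"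
    if "s ''L'' [] = int L" "s ''K'' [] = int K" "s ''D'' = codes_table K 0 0 0"
      "s ''W'' = (\<lambda>_. 0)" for s
    by (rule wp_Seq[OF wp_mono[OF wp_weave_prog[where K = K and d = "codes_table K 0 0 0"]
            order_refl wp_codes_prog] order_refl])
       (use that pos in simp_all)
  have setK: "wp ?B (Seq (Assign ''K'' [] (Op Add (Var ''M'') (Num 1))) (Seq weave_prog codes_prog))
      (3 + ?t) ?Q s"
    if "s ''L'' [] = int L" "s ''M'' [] = int M" "s ''D'' = codes_table K 0 0 0"
      "s ''W'' = (\<lambda>_. 0)" for s
    by (rule wp_Seq[OF wp_Assign[OF _ _ main] order_refl]) (use that K in simp_all)
  have setL: "wp ?B (Seq (Assign ''L'' [] (Op Add (Var ''N'') (Num 1)))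
      (Seq (Assign ''K'' [] (Op Add (Var ''M'') (Num 1))) (Seq weave_prog codes_prog)))
      (3 + (3 + ?t)) ?Q s"
    if "s ''N'' [] = int N" "s ''M'' [] = int M" "s ''D'' = codes_table K 0 0 0"
      "s ''W'' = (\<lambda>_. 0)" for s
    by (rule wp_Seq[OF wp_Assign[OF _ _ setK] order_refl]) (use that L in simp_all)
  have branch: "wp ?B (If_Less (Var ''N'') (Num 2) (Assign ''D'' [Num 1, Num 0, Num 1] (Num 1))
      (Seq (Assign ''L'' [] (Op Add (Var ''N'') (Num 1)))
        (Seq (Assign ''K'' [] (Op Add (Var ''M'') (Num 1))) (Seq weave_prog codes_prog))))
      (7 + ?t) ?Q s"
    if "s ''N'' [] = int N" "s ''M'' [] = int M" "s ''D'' = codes_table K 0 0 0"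
      "s ''W'' = (\<lambda>_. 0)" for s
    by (rule wp_If[where t' = "6 + ?t"]) (use that N setL[OF that] in simp_all)
  have "L ^ 3 * 1 \<le> L ^ 3 * (L * K)" using pos by (intro mult_le_mono) auto
  also have "\<dots> = L ^ 4 * K" by (simp add: power4_eq_xxxx power3_eq_cube)
  finally have "L ^ 3 \<le> L ^ 4 * K" by simp
  moreover have "1 \<le> L ^ 4 * K" using pos by simp
  \<comment> \<open>The 9 set-up operations and the coefficients 23 and 38 add up to 70.\<close>
  ultimately have time: "2 + (7 + ?t) \<le> 70 * L ^ 4 * K"
    by linarith
  show ?thesis
    unfolding doag_prog_def
    by (rule wp_Seq[OF wp_Assign[OF _ _ branch] time])
       (use pos in \<open>simp_all add: codes_table_0[symmetric] input_def fun_eq_iff\<close>)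
qed

text \<open>This run performs no multiplication, so the operand bound 0 holds.\<close>

lemma wp_doag_prog_1:
  "wp 0 doag_prog 5 (\<lambda>s. s ''D'' = (\<lambda>_. 0)([0, 0, 0] := 1, [1, 0, 1] := 1)) (input 1 M)"
proof -
  have "wp 0 (If_Less (Var ''N'') (Num 2) (Assign ''D'' [Num 1, Num 0, Num 1] (Num 1)) c) 3
      (\<lambda>s. s ''D'' = (\<lambda>_. 0)([0, 0, 0] := 1, [1, 0, 1] := 1)) s"
    if "s ''N'' [] = 1" "s ''D'' = (\<lambda>_. 0)([0, 0, 0] := 1)" for s c
    by (rule wp_If[where t' = 2]) (use that in \<open>auto intro!: wp_Assign\<close>)
  then show ?thesis
    unfolding doag_prog_def
    by (intro wp_Seq[where t = 2 and u = 3] wp_Assign) (simp_all add: input_def)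
qed

section \<open>Table values and bit-sizes\<close>

lemma num_doags_le_1:
  assumes "n \<le> 1" "k \<le> n"
  shows "num_doags n m k = (if m = 0 \<and> k = n then 1 else 0)"
proof (cases n)
  case 0
  then show ?thesis using assms by (simp add: num_doags_eq_card_codes codes_0)
next
  case (Suc n')
  then have "n' = 0" using assms by simp
  then show ?thesis
    using Suc assms(2) card_codes_Suc_Suc[of 0 1 m 0]
    by (cases k) (auto simp: num_doags_eq_card_codes codes_Suc_0 card_code_steps codes_0)
qed

lemma codes_table_eq_num_doags:
  assumes "n < L" "m < K"
  shows "codes_table K L 0 0 [int n, int m, int k] = int (num_doags n m k)"
  using assms by (simp add: codes_table_def codes_at_def num_doags_eq_card_codes)

lemma bit_size_le_log:
  assumes "\<bar>x\<bar> \<le> b" "1 \<le> b"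
  shows "bit_size x \<le> log 2 (of_int b) + 1"
proof (cases "x = 0")
  case True
  then show ?thesis using assms(2) by (simp add: bit_size_def bitlen_alt_def)
next
  case False
  then have "bit_size x = of_int \<lfloor>log 2 (of_int \<bar>x\<bar>)\<rfloor> + 1"
    by (simp add: bit_size_def bitlen_alt_def)
  also have "\<dots> \<le> log 2 (of_int \<bar>x\<bar>) + 1" by simp
  also have "log 2 (of_int \<bar>x\<bar>) \<le> log 2 (of_int b)"
    using False assms by (simp del: of_int_abs)
  finally show ?thesis by simp
qed

text \<open>Since \<open>N + 1 \<le> N ^ 2\<close>, the logarithm of the base costs a factor 2, and
  the exponent is at most 6 times \<open>max M N\<close>. The resulting 12 becomes 13 by absorbing
  the additive 1 of the bit-size, as \<open>y\<close> is at least 1.\<close>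

lemma bit_size_op_bound:
  assumes "2 \<le> N" "0 < M" "\<bar>x\<bar> \<le> op_bound (N + 1) (M + 1)"
  shows "bit_size x \<le> 13 / ln 2 * (real (max M N) * ln (real N))"
proof -
  let ?X = "real (max M N)"
  have ln: "0 < ln (2 :: real)" "ln 2 \<le> ln (real N)" using assms(1) by auto
  have "ln (real N + 1) \<le> ln (real N ^ 2)"
  proof (subst ln_le_cancel_iff)
    have "real N * 2 \<le> real N * real N" using assms(1) by (intro mult_left_mono) auto
    moreover have "real N + 1 \<le> real N * 2" using assms(1) by simp
    ultimately show "real N + 1 \<le> real N ^ 2" unfolding power2_eq_square by linarith
  qed (use assms(1) in auto)
  also have "\<dots> = 2 * ln (real N)" using assms(1) by (simp add: ln_realpow)
  finally have "ln (real N + 1) / ln 2 \<le> 2 * ln (real N) / ln 2"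
    using ln by (intro divide_right_mono) auto
  then have log: "log 2 (real N + 1) \<le> 2 * (ln (real N) / ln 2)" by (simp add: log_def)
  have X: "real (2 * (N + 1) + (M + 1)) \<le> 6 * ?X" "1 \<le> ?X" using assms(1,2) by auto
  define y where "y = ?X * (ln (real N) / ln 2)"
  have "1 * 1 \<le> y" unfolding y_def using X ln by (intro mult_mono) auto
  have "bit_size x \<le> log 2 (of_int (op_bound (N + 1) (M + 1))) + 1"
    by (rule bit_size_le_log[OF assms(3)]) (unfold op_bound_def, rule one_le_power, simp)
  also have "log 2 (of_int (op_bound (N + 1) (M + 1))) =
      log 2 ((real N + 1) ^ (2 * (N + 1) + (M + 1)))"
    by (simp only: op_bound_def of_int_power of_int_of_nat_eq of_nat_add of_nat_1
        of_int_add of_int_1)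
  also have "\<dots> = real (2 * (N + 1) + (M + 1)) * log 2 (real N + 1)"
    by (rule log_nat_power) simp
  also have "\<dots> \<le> (6 * ?X) * (2 * (ln (real N) / ln 2))"
    using X log assms(1) by (intro mult_mono) auto
  also have "\<dots> = 12 * y" by (simp add: y_def)
  finally have "bit_size x \<le> 12 * y + 1" by simp
  with \<open>1 * 1 \<le> y\<close> have "bit_size x \<le> 13 * y" by linarith
  then show ?thesis by (simp add: y_def)
qed

lemma length_mults_le: "length (mults tr) \<le> length tr"
  unfolding mults_def by (induction tr) (auto split: event.split arith_op.split)

text \<open>The program and the constants are chosen before \<open>N\<close> and \<open>M\<close>,
  so one uniform algorithm serves all inputs. The last conjunct bounds all elementary operations, so
  multiplications cannot be replaced by a larger order of additions.\<close>

theorem theorem2p4: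
  shows "\<exists>(P :: com) (C\<^sub>1 :: real) (C\<^sub>2 :: real) (C\<^sub>3 :: real).
    \<forall>(N :: nat) (M :: nat). N > 0 \<longrightarrow> M > 0 \<longrightarrow>
      (\<exists>tr s. exec P (input N M) tr s \<and>
        (\<forall>n\<le>N. \<forall>m\<le>M. \<forall>k\<le>n. s ''D'' [int n, int m, int k] = int (num_doags n m k)) \<and>
        real (length (mults tr)) \<le> C\<^sub>1 * (real N ^ 4 * real M) \<and>
        (\<forall>(x, y)\<in>set (mults tr).
           bit_size x \<le> C\<^sub>2 * (real (max M N) * ln (real N)) \<and>
           bit_size y \<le> C\<^sub>2 * (real (max M N) * ln (real N))) \<and>
        real (length tr) \<le> C\<^sub>3 * (real N ^ 4 * real M))"
proof (rule exI[of _ doag_prog], rule exI[of _ 2240], rule exI[of _ "13 / ln 2"],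
    rule exI[of _ 2240], intro allI impI)
  fix N M :: nat
  assume N: "N > 0" and M: "M > 0"
  \<comment> \<open>Both cases supply the same facts; the operand bound \<open>B\<close> is 0 for
    \<open>N = 1\<close> and \<open>op_bound (N + 1) (M + 1)\<close> otherwise.\<close>
  obtain tr s B where run: "exec doag_prog (input N M) tr s"
    and table: "\<And>n m k. n \<le> N \<Longrightarrow> m \<le> M \<Longrightarrow> k \<le> n \<Longrightarrow>
      s ''D'' [int n, int m, int k] = int (num_doags n m k)"
    and time: "length tr \<le> 2240 * (N ^ 4 * M)" and small: "small_mults B tr"
    and bits: "\<And>x. \<bar>x\<bar> \<le> B \<Longrightarrow> bit_size x \<le> 13 / ln 2 * (real (max M N) * ln (real N))"
  proof (cases "N = 1")
    case True
    obtain tr s where run: "exec doag_prog (input 1 M) tr s"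
      and D: "s ''D'' = (\<lambda>_. 0)([0, 0, 0] := 1, [1, 0, 1] := 1)"
      and tr: "length tr \<le> 5" "small_mults 0 tr"
      using wp_doag_prog_1[of M] unfolding wp_def by blast
    show ?thesis
    proof (rule that[of tr s 0])
      fix n m k assume "n \<le> N" "m \<le> M" "k \<le> n"
      then show "s ''D'' [int n, int m, int k] = int (num_doags n m k)"
        using True num_doags_le_1[of n k m] by (cases n) (auto simp: D)
    next
      fix x :: int assume "\<bar>x\<bar> \<le> 0"
      then show "bit_size x \<le> 13 / ln 2 * (real (max M N) * ln (real N))"
        using True by (simp add: bit_size_def bitlen_alt_def)
    qed (use run tr True M in auto)
  next
    case False
    then have N2: "2 \<le> N" using N by simp
    obtain tr s where run: "exec doag_prog (input N M) tr s"
      and D: "s ''D'' = codes_table (M + 1) (N + 1) 0 0"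
      and tr: "length tr \<le> 70 * (N + 1) ^ 4 * (M + 1)" "small_mults (op_bound (N + 1) (M + 1)) tr"
      using wp_doag_prog[OF N2, of "N + 1" "M + 1" M] unfolding wp_def by auto
    show ?thesis
    proof (rule that[OF run _ _ tr(2)])
      \<comment> \<open>By \<open>N + 1 \<le> 2 * N\<close> and \<open>M + 1 \<le> 2 * M\<close>,
        the constant becomes \<open>70 * 2 ^ 4 * 2 = 2240\<close>.\<close>
      have "70 * (N + 1) ^ 4 * (M + 1) \<le> 70 * (2 * N) ^ 4 * (2 * M)"
        using N M by (intro mult_le_mono power_mono) auto
      also have "\<dots> = 2240 * (N ^ 4 * M)" by (simp add: power_mult_distrib)
      finally show "length tr \<le> 2240 * (N ^ 4 * M)" using tr(1) by linarith
    qed (use codes_table_eq_num_doags bit_size_op_bound[OF N2 M] in \<open>auto simp: D\<close>)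
  qed
  have C: "real (length tr) \<le> 2240 * (real N ^ 4 * real M)"
    using of_nat_mono[OF time, where 'a = real] by simp
  moreover have "real (length (mults tr)) \<le> 2240 * (real N ^ 4 * real M)"
    using C length_mults_le[of tr] by linarith
  moreover have "\<forall>(x, y)\<in>set (mults tr).
      bit_size x \<le> 13 / ln 2 * (real (max M N) * ln (real N)) \<and>
      bit_size y \<le> 13 / ln 2 * (real (max M N) * ln (real N))"
    using small bits unfolding small_mults_def by blast
  ultimately show "\<exists>tr s. exec doag_prog (input N M) tr s \<and>
    (\<forall>n\<le>N. \<forall>m\<le>M. \<forall>k\<le>n. s ''D'' [int n, int m, int k] = int (num_doags n m k)) \<and>
    real (length (mults tr)) \<le> 2240 * (real N ^ 4 * real M) \<and>
    (\<forall>(x, y)\<in>set (mults tr).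
       bit_size x \<le> 13 / ln 2 * (real (max M N) * ln (real N)) \<and>
       bit_size y \<le> 13 / ln 2 * (real (max M N) * ln (real N))) \<and>
    real (length tr) \<le> 2240 * (real N ^ 4 * real M)"
    using run table by blast
qed

end
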